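(* Let $G$ be an essentially principal étale groupoid whose unit space is a Cantor set. Suppose that $G$ is minimal. Then any subgroup $\Gamma\subset[[G]]$ containing the commutator subgroup $D([[G]])$ is of class F (as a subgroup of $\mathrm{Homeo}(G^{(0)})$).
   Context: A Cantor set is a (non-empty) compact, metrizable, totally disconnected space with no isolated points. Clopen means closed and open. For $\alpha\in\mathrm{Homeo}(X)$, $\mathrm{supp}(\alpha)$ is the closure of $\{x\in X\mid\alpha(x)\neq x\}$. An étale groupoid is a second countable locally compact Hausdorff topological groupoid $G$ whose range map is a local homeomorphism. $G^{(0)}$ is the unit space, $s,r$ are the source and range maps, and $gh$ is defined when $s(g)=r(h)$. The $G$-orbit of $x\in G^{(0)}$ is $\{r(g)\mid g\in G,\ s(g)=x\}$; $G$ is minimal if every $G$-orbit is dense in $G^{(0)}$. $G$ is essentially principal if the interior of $\{g\in G\mid r(g)=s(g)\}$ is $G^{(0)}$. A $G$-set is a subset $U\subset G$ such that $r|U$ and $s|U$ are injective; for an open $G$-set $U$, $\pi_U=r\circ(s|U)^{-1}:s(U)\to r(U)$ (a homeomorphism). When $G^{(0)}$ is compact, the topological full group $[[G]]$ is the group of all $\alpha\in\mathrm{Homeo}(G^{(0)})$ for which there is a compact open $G$-set $U$ with $\alpha=\pi_U$ (so $s(U)=r(U)=G^{(0)}$). $D(\Gamma)$ denotes the commutator subgroup of a group $\Gamma$. A subgroup $\Gamma\subset\mathrm{Homeo}(X)$, $X$ a Cantor set, is of class F if: (F0) for any $\alpha\in\Gamma$ with $\alpha^2=1$, $\mathrm{supp}(\alpha)$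 is clopen; (F1) for any $x\in X$ and any clopen neighborhood $A\subset X$ of $x$, there exists $\alpha\in\Gamma\setminus\{1\}$ such that $x\in\mathrm{supp}(\alpha)$, $\mathrm{supp}(\alpha)\subset A$ and $\alpha^2=1$; (F2) for any $\alpha\in\Gamma\setminus\{1\}$ with $\alpha^2=1$ and any non-empty clopen set $A\subset\mathrm{supp}(\alpha)$, there exists $\beta\in\Gamma\setminus\{1\}$ such that $\mathrm{supp}(\beta)\subset A\cup\alpha(A)$ and $\beta(x)=\alpha(x)$ for every $x\in\mathrm{supp}(\beta)$; (F3) for any non-empty clopen set $A\subset X$, there exists $\alpha\in\Gamma$ such that $\mathrm{supp}(\alpha)\subset A$ and $\alpha^2\neq1$. *)

theory Defs
  imports "HOL-Algebra.Bij" "HOL-Algebra.Generated_Groups" "HOL-Analysis.Analysis"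
begin

section \<open>Topological preliminaries\<close>

definition second_countable :: "'a topology \<Rightarrow> bool" where
  "second_countable X \<longleftrightarrow>
     (\<exists>\<B>. countable \<B> \<and> openin X = arbitrary union_of (\<lambda>V. V \<in> \<B>))"

definition totally_disconnected_space :: "'a topology \<Rightarrow> bool" where
  "totally_disconnected_space X \<longleftrightarrow>
     (\<forall>C. connectedin X C \<longrightarrow> (\<forall>x\<in>C. \<forall>y\<in>C. x = y))"

definition cantor_space :: "'a topology \<Rightarrow> bool" where
  "cantor_space X \<longleftrightarrow>
     topspace X \<noteq> {} \<and> compact_space X \<and> metrizable_space X \<and>
     totally_disconnected_space X \<and> (\<forall>x\<in>topspace X. \<not> openin X {x})"

definition clopenin :: "'a topology \<Rightarrow> 'a set \<Rightarrow> bool" where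
  "clopenin X A \<longleftrightarrow> closedin X A \<and> openin X A"

definition local_homeomorphism :: "'a topology \<Rightarrow> 'b topology \<Rightarrow> ('a \<Rightarrow> 'b) \<Rightarrow> bool" where
  "local_homeomorphism X Y f \<longleftrightarrow>
     f \<in> topspace X \<rightarrow> topspace Y \<and>
     (\<forall>x\<in>topspace X. \<exists>U. openin X U \<and> x \<in> U \<and> openin Y (f ` U) \<and>
        homeomorphic_map (subtopology X U) (subtopology Y (f ` U)) f)"

section \<open>Homeomorphism groups and class F\<close>

text \<open>As in \<^const>\<open>BijGroup\<close>, a self-homeomorphism is represented by the unique function
  extending it that is \<^const>\<open>undefined\<close> off the space; the product is composition.\<close>

definition homeo_group :: "'a topology \<Rightarrow> ('a \<Rightarrow> 'a) monoid" where
  "homeo_group X =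
     BijGroup (topspace X) \<lparr>carrier := {f \<in> extensional (topspace X). homeomorphic_map X X f}\<rparr>"

definition supp :: "'a topology \<Rightarrow> ('a \<Rightarrow> 'a) \<Rightarrow> 'a set" where
  "supp X \<alpha> = X closure_of {x \<in> topspace X. \<alpha> x \<noteq> x}"

definition class_F :: "'a topology \<Rightarrow> ('a \<Rightarrow> 'a) set \<Rightarrow> bool" where
  "class_F X \<Gamma> \<longleftrightarrow>
     cantor_space X \<and> subgroup \<Gamma> (homeo_group X) \<and>
     \<comment> \<open>(F0)\<close>
     (\<forall>\<alpha>\<in>\<Gamma>. \<alpha> [^]\<^bsub>homeo_group X\<^esub> (2::nat) = \<one>\<^bsub>homeo_group X\<^esub> \<longrightarrow> clopenin X (supp X \<alpha>)) \<and>
     \<comment> \<open>(F1)\<close>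
     (\<forall>x\<in>topspace X. \<forall>A. clopenin X A \<and> x \<in> A \<longrightarrow>
        (\<exists>\<alpha>\<in>\<Gamma> - {\<one>\<^bsub>homeo_group X\<^esub>}. x \<in> supp X \<alpha> \<and> supp X \<alpha> \<subseteq> A \<and>
           \<alpha> [^]\<^bsub>homeo_group X\<^esub> (2::nat) = \<one>\<^bsub>homeo_group X\<^esub>)) \<and>
     \<comment> \<open>(F2)\<close>
     (\<forall>\<alpha>\<in>\<Gamma> - {\<one>\<^bsub>homeo_group X\<^esub>}. \<forall>A.
        \<alpha> [^]\<^bsub>homeo_group X\<^esub> (2::nat) = \<one>\<^bsub>homeo_group X\<^esub> \<and>
        clopenin X A \<and> A \<noteq> {} \<and> A \<subseteq> supp X \<alpha> \<longrightarrow>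
        (\<exists>\<beta>\<in>\<Gamma> - {\<one>\<^bsub>homeo_group X\<^esub>}. supp X \<beta> \<subseteq> A \<union> \<alpha> ` A \<and>
           (\<forall>x\<in>supp X \<beta>. \<beta> x = \<alpha> x))) \<and>
     \<comment> \<open>(F3)\<close>
     (\<forall>A. clopenin X A \<and> A \<noteq> {} \<longrightarrow>
        (\<exists>\<alpha>\<in>\<Gamma>. supp X \<alpha> \<subseteq> A \<and>
           \<alpha> [^]\<^bsub>homeo_group X\<^esub> (2::nat) \<noteq> \<one>\<^bsub>homeo_group X\<^esub>))"

section \<open>Etale groupoids\<close>

text \<open>A groupoid is given by its set of arrows, the underlying set of \<open>gtop\<close>; its units are
  identified with the identity arrows, so that range and source map arrows to arrows.
  The values of \<open>gmult\<close> at non-composable pairs are irrelevant.\<close>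

record 'g top_groupoid =
  gtop :: "'g topology"
  rng :: "'g \<Rightarrow> 'g"
  src :: "'g \<Rightarrow> 'g"
  gmult :: "'g \<Rightarrow> 'g \<Rightarrow> 'g"
  ginv :: "'g \<Rightarrow> 'g"

definition arrows :: "'g top_groupoid \<Rightarrow> 'g set" where
  "arrows G = topspace (gtop G)"

definition units :: "'g top_groupoid \<Rightarrow> 'g set" where
  "units G = rng G ` arrows G"

definition unit_space :: "'g top_groupoid \<Rightarrow> 'g topology" where
  "unit_space G = subtopology (gtop G) (units G)"

definition composable :: "'g top_groupoid \<Rightarrow> ('g \<times> 'g) set" where
  "composable G = {(g, h). g \<in> arrows G \<and> h \<in> arrows G \<and> src G g = rng G h}"

definition is_groupoid :: "'g top_groupoid \<Rightarrow> bool" where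
  "is_groupoid G \<longleftrightarrow>
     (\<forall>g\<in>arrows G. rng G g \<in> arrows G \<and> src G g \<in> arrows G \<and> ginv G g \<in> arrows G) \<and>
     (\<forall>g\<in>arrows G. rng G (rng G g) = rng G g \<and> src G (rng G g) = rng G g \<and>
                    rng G (src G g) = src G g \<and> src G (src G g) = src G g) \<and>
     (\<forall>(g, h)\<in>composable G. gmult G g h \<in> arrows G \<and>
                    rng G (gmult G g h) = rng G g \<and> src G (gmult G g h) = src G h) \<and>
     (\<forall>g h k. (g, h) \<in> composable G \<and> (h, k) \<in> composable G \<longrightarrow>
                    gmult G (gmult G g h) k = gmult G g (gmult G h k)) \<and>
     (\<forall>g\<in>arrows G. gmult G (rng G g) g = g \<and> gmult G g (src G g) = g) \<and>
     (\<forall>g\<in>arrows G. rng G (ginv G g) = src G g \<and> src G (ginv G g) = rng G g \<and>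
                    gmult G g (ginv G g) = rng G g \<and> gmult G (ginv G g) g = src G g)"

text \<open>Continuity of range and source need not be required: they are the maps
  \<open>g \<mapsto> g g\<inverse>\<close> and \<open>g \<mapsto> g\<inverse> g\<close>.\<close>

definition topological_groupoid :: "'g top_groupoid \<Rightarrow> bool" where
  "topological_groupoid G \<longleftrightarrow>
     is_groupoid G \<and>
     continuous_map (subtopology (prod_topology (gtop G) (gtop G)) (composable G)) (gtop G)
       (\<lambda>(g, h). gmult G g h) \<and>
     continuous_map (gtop G) (gtop G) (ginv G)"

definition etale_groupoid :: "'g top_groupoid \<Rightarrow> bool" where
  "etale_groupoid G \<longleftrightarrow>
     topological_groupoid G \<and> second_countable (gtop G) \<and>
     locally_compact_space (gtop G) \<and> Hausdorff_space (gtop G) \<and>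
     local_homeomorphism (gtop G) (unit_space G) (rng G)"

definition orbit :: "'g top_groupoid \<Rightarrow> 'g \<Rightarrow> 'g set" where
  "orbit G x = {rng G g | g. g \<in> arrows G \<and> src G g = x}"

definition minimal_groupoid :: "'g top_groupoid \<Rightarrow> bool" where
  "minimal_groupoid G \<longleftrightarrow>
     (\<forall>x\<in>units G. unit_space G closure_of orbit G x = units G)"

definition essentially_principal :: "'g top_groupoid \<Rightarrow> bool" where
  "essentially_principal G \<longleftrightarrow>
     gtop G interior_of {g \<in> arrows G. rng G g = src G g} = units G"

section \<open>Topological full groups\<close>

definition G_set :: "'g top_groupoid \<Rightarrow> 'g set \<Rightarrow> bool" where
  "G_set G U \<longleftrightarrow> U \<subseteq> arrows G \<and> inj_on (rng G) U \<and> inj_on (src G) U"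

definition G_set_map :: "'g top_groupoid \<Rightarrow> 'g set \<Rightarrow> 'g \<Rightarrow> 'g" where
  "G_set_map G U = (\<lambda>x \<in> src G ` U. rng G (inv_into U (src G) x))"

text \<open>Since \<^const>\<open>G_set_map\<close> is a total function, an equation \<open>\<alpha> = G_set_map G U\<close> does not
  determine the domain of the partial homeomorphism; hence the explicit conditions on the
  source and range of \<open>U\<close>.\<close>

definition topological_full_group :: "'g top_groupoid \<Rightarrow> ('g \<Rightarrow> 'g) monoid" where
  "topological_full_group G = (homeo_group (unit_space G))
     \<lparr>carrier := {\<alpha> \<in> carrier (homeo_group (unit_space G)).
        \<exists>U. openin (gtop G) U \<and> compactin (gtop G) U \<and> G_set G U \<and>
            src G ` U = units G \<and> rng G ` U = units G \<and> \<alpha> = G_set_map G U}\<rparr>"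

definition commutator_subgroup :: "('a, 'b) monoid_scheme \<Rightarrow> 'a set" where
  "commutator_subgroup H = derived H (carrier H)"

end

theory Submission
  imports Defs
begin

text \<open>Call a group \<open>K\<close> of homeomorphisms of a Cantor set ample if it contains every homeomorphism
  that locally agrees with elements of \<open>K\<close>. If moreover supports are clopen and every point can be
  moved inside each of its clopen neighbourhoods, then \<open>K\<close> contains many small involutions, and
  commutators of such involutions witness (F1), (F2) and (F3): a small restriction \<open>\<tau>\<close> of an
  involution \<open>\<alpha>\<close> and an involution \<open>\<sigma>\<close> commuting with \<open>\<alpha>\<close> and displacing \<open>supp \<tau>\<close> have as
  commutator another restriction of \<open>\<alpha>\<close>, while two transpositions sharing one point have a
  3-cycle as commutator. The topological full group is ample because a homeomorphism that is locally
  given by open \<open>G\<close>-sets is given by one compact open \<open>G\<close>-set; essential principality makes the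
  supports clopen, and minimality moves the points.\<close>

section \<open>Homeomorphism groups\<close>

lemma carrier_homeo_group:
  "f \<in> carrier (homeo_group X) \<longleftrightarrow> f \<in> extensional (topspace X) \<and> homeomorphic_map X X f"
  by (simp add: homeo_group_def)

lemma one_homeo_group: "\<one>\<^bsub>homeo_group X\<^esub> = (\<lambda>x\<in>topspace X. x)"
  by (simp add: homeo_group_def BijGroup_def)

lemma homeo_group_Bij: "f \<in> carrier (homeo_group X) \<Longrightarrow> f \<in> Bij (topspace X)"
  by (auto simp: carrier_homeo_group Bij_def bij_betw_def homeomorphic_eq_everything_map)

lemma mult_homeo_group:
  assumes "f \<in> carrier (homeo_group X)" "g \<in> carrier (homeo_group X)"
  shows "f \<otimes>\<^bsub>homeo_group X\<^esub> g = compose (topspace X) f g"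
  using homeo_group_Bij[OF assms(1)] homeo_group_Bij[OF assms(2)]
  by (simp add: homeo_group_def BijGroup_def)

lemma homeo_group_apply_mem:
  "f \<in> carrier (homeo_group X) \<Longrightarrow> x \<in> topspace X \<Longrightarrow> f x \<in> topspace X"
  using homeo_group_Bij Bij_imp_funcset by blast

lemma homeo_group_eqI:
  assumes "f \<in> carrier (homeo_group X)" "g \<in> carrier (homeo_group X)"
    and "\<And>x. x \<in> topspace X \<Longrightarrow> f x = g x"
  shows "f = g"
  using assms by (auto simp: carrier_homeo_group intro: extensionalityI)

lemma homeomorphic_map_cong:
  assumes "homeomorphic_map X Y f" "\<And>x. x \<in> topspace X \<Longrightarrow> f x = g x"
  shows "homeomorphic_map X Y g"
  using homeomorphic_map_eq assms by metis

lemma group_homeo_group: "group (homeo_group X)"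
proof (rule groupI)
  let ?H = "homeo_group X"
  have comp: "compose (topspace X) f g \<in> carrier ?H" if "f \<in> carrier ?H" "g \<in> carrier ?H" for f g
  proof -
    have "homeomorphic_map X X (f \<circ> g)"
      using that by (auto simp: carrier_homeo_group intro: homeomorphic_map_compose)
    then have "homeomorphic_map X X (compose (topspace X) f g)"
      by (rule homeomorphic_map_cong) (simp add: compose_def)
    then show ?thesis by (simp add: carrier_homeo_group)
  qed
  then show "f \<otimes>\<^bsub>?H\<^esub> g \<in> carrier ?H" if "f \<in> carrier ?H" "g \<in> carrier ?H" for f g
    using that by (simp add: mult_homeo_group)
  show one: "\<one>\<^bsub>?H\<^esub> \<in> carrier ?H"
    unfolding carrier_homeo_group one_homeo_group
    by (auto intro: homeomorphic_map_cong[of X X id])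
  show "f \<otimes>\<^bsub>?H\<^esub> g \<otimes>\<^bsub>?H\<^esub> h = f \<otimes>\<^bsub>?H\<^esub> (g \<otimes>\<^bsub>?H\<^esub> h)"
    if "f \<in> carrier ?H" "g \<in> carrier ?H" "h \<in> carrier ?H" for f g h
    using that comp homeo_group_apply_mem[OF that(3)]
    by (auto simp: mult_homeo_group compose_def fun_eq_iff)
  show "\<one>\<^bsub>?H\<^esub> \<otimes>\<^bsub>?H\<^esub> f = f" if f: "f \<in> carrier ?H" for f
    using mult_homeo_group[OF one f] homeo_group_apply_mem[OF f] f
    by (auto simp: carrier_homeo_group compose_def one_homeo_group restrict_def extensional_def fun_eq_iff)
  show "\<exists>g\<in>carrier ?H. g \<otimes>\<^bsub>?H\<^esub> f = \<one>\<^bsub>?H\<^esub>" if f: "f \<in> carrier ?H" for f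
  proof -
    obtain g where g: "homeomorphic_maps X X f g"
      using f by (auto simp: carrier_homeo_group homeomorphic_map_maps)
    \<comment> \<open>The inverse provided by \<open>homeomorphic_maps\<close> is arbitrary off the
      space; its restriction is the representative that lies in the carrier.\<close>
    have "homeomorphic_map X X (restrict g (topspace X))"
      using g homeomorphic_maps_map homeomorphic_map_cong[of X X g "restrict g (topspace X)"]
      by fastforce
    then have r: "restrict g (topspace X) \<in> carrier ?H"
      by (simp add: carrier_homeo_group)
    moreover have "restrict g (topspace X) \<otimes>\<^bsub>?H\<^esub> f = \<one>\<^bsub>?H\<^esub>"
      unfolding mult_homeo_group[OF r f]
      using g homeo_group_apply_mem[OF f]
      by (auto simp: one_homeo_group compose_def homeomorphic_maps_def fun_eq_iff)
    ultimately show ?thesis by blast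
  qed
qed

lemma mult_homeo_group_apply:
  assumes "f \<in> carrier (homeo_group X)" "g \<in> carrier (homeo_group X)" "x \<in> topspace X"
  shows "(f \<otimes>\<^bsub>homeo_group X\<^esub> g) x = f (g x)"
  using assms by (simp add: mult_homeo_group compose_def)

lemma inv_homeo_group_apply:
  assumes "f \<in> carrier (homeo_group X)" "x \<in> topspace X"
  shows "(inv\<^bsub>homeo_group X\<^esub> f) (f x) = x" "f ((inv\<^bsub>homeo_group X\<^esub> f) x) = x"
proof -
  interpret group "homeo_group X" by (rule group_homeo_group)
  show "(inv\<^bsub>homeo_group X\<^esub> f) (f x) = x" "f ((inv\<^bsub>homeo_group X\<^esub> f) x) = x"
    using assms mult_homeo_group_apply[of "inv\<^bsub>homeo_group X\<^esub> f" X f x]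
      mult_homeo_group_apply[of f X "inv\<^bsub>homeo_group X\<^esub> f" x]
    by (auto simp: one_homeo_group)
qed

lemma homeo_group_square_eq_one_iff:
  assumes "f \<in> carrier (homeo_group X)"
  shows "f [^]\<^bsub>homeo_group X\<^esub> (2::nat) = \<one>\<^bsub>homeo_group X\<^esub> \<longleftrightarrow> (\<forall>x\<in>topspace X. f (f x) = x)"
proof -
  interpret group "homeo_group X" by (rule group_homeo_group)
  have "f [^]\<^bsub>homeo_group X\<^esub> (2::nat) = f \<otimes>\<^bsub>homeo_group X\<^esub> f"
    using assms by (simp add: numeral_2_eq_2)
  moreover have "f \<otimes>\<^bsub>homeo_group X\<^esub> f = \<one>\<^bsub>homeo_group X\<^esub> \<longleftrightarrow> (\<forall>x\<in>topspace X. f (f x) = x)"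
    using assms by (auto simp: mult_homeo_group one_homeo_group compose_def fun_eq_iff restrict_def)
  ultimately show ?thesis by simp
qed

lemma homeo_group_neq_one_iff:
  assumes "f \<in> carrier (homeo_group X)"
  shows "f \<noteq> \<one>\<^bsub>homeo_group X\<^esub> \<longleftrightarrow> (\<exists>x\<in>topspace X. f x \<noteq> x)"
proof -
  interpret group "homeo_group X" by (rule group_homeo_group)
  show ?thesis
    using homeo_group_eqI[OF assms one_closed] by (auto simp: one_homeo_group)
qed

lemma in_supp: "x \<in> topspace X \<Longrightarrow> f x \<noteq> x \<Longrightarrow> x \<in> supp X f"
  unfolding supp_def using closure_of_subset[of "{x \<in> topspace X. f x \<noteq> x}" X] by blast

lemma supp_subset:
  assumes "closedin X T" "\<And>x. x \<in> topspace X \<Longrightarrow> f x \<noteq> x \<Longrightarrow> x \<in> T"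
  shows "supp X f \<subseteq> T"
  unfolding supp_def using assms by (intro closure_of_minimal) auto

section \<open>Clopen sets in Cantor spaces\<close>

lemma clopenin_Int: "clopenin X A \<Longrightarrow> clopenin X B \<Longrightarrow> clopenin X (A \<inter> B)"
  by (auto simp: clopenin_def)

lemma clopenin_Un: "clopenin X A \<Longrightarrow> clopenin X B \<Longrightarrow> clopenin X (A \<union> B)"
  by (auto simp: clopenin_def)

lemma clopenin_Diff: "clopenin X A \<Longrightarrow> clopenin X B \<Longrightarrow> clopenin X (A - B)"
  by (auto simp: clopenin_def)

lemma clopenin_subset: "clopenin X A \<Longrightarrow> A \<subseteq> topspace X"
  by (simp add: clopenin_def openin_subset)

lemma clopenin_preimage:
  assumes "f \<in> carrier (homeo_group X)" "clopenin X A"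
  shows "clopenin X {x \<in> topspace X. f x \<in> A}"
proof -
  have "continuous_map X X f"
    using assms by (simp add: carrier_homeo_group homeomorphic_imp_continuous_map)
  then show ?thesis
    using assms by (auto simp: clopenin_def openin_continuous_map_preimage closedin_continuous_map_preimage)
qed

lemma cantor_space_imp_Hausdorff: "cantor_space X \<Longrightarrow> Hausdorff_space X"
  by (simp add: cantor_space_def metrizable_imp_Hausdorff_space)

text \<open>Connected sets have at most one point, so none meets both \<open>x\<close> and the
  closed complement of \<open>U\<close>; in a compact Hausdorff space the cut wire fence theorem
  then separates the two by a clopen set.\<close>

lemma cantor_space_clopen_base:
  assumes X: "cantor_space X" and U: "openin X U" and x: "x \<in> U"
  obtains A where "clopenin X A" "x \<in> A" "A \<subseteq> U"
proof -
  have xX: "x \<in> topspace X" using U x openin_subset by blast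
  have "separated_between X {x} (topspace X - U)"
  proof (rule cut_wire_fence_theorem)
    show "disjnt C {x} \<or> disjnt C (topspace X - U)" if "connectedin X C" for C
    proof -
      have "\<forall>y\<in>C. \<forall>z\<in>C. y = z"
        using X that by (simp add: cantor_space_def totally_disconnected_space_def)
      then have "x \<notin> C \<or> C \<subseteq> {x}" by blast
      then show ?thesis using x by (auto simp: disjnt_def)
    qed
    show "Hausdorff_space X" by (rule cantor_space_imp_Hausdorff[OF X])
    then show "closedin X {x}" using xX by (rule closedin_Hausdorff_singleton)
  qed (use X U in \<open>auto simp: cantor_space_def\<close>)
  then obtain A where A: "closedin X A" "openin X A" "{x} \<subseteq> A" "topspace X - U \<subseteq> topspace X - A"
    by (auto simp: separated_between)
  then show ?thesis
    using openin_subset[OF A(2)] that[of A] by (auto simp: clopenin_def)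
qed

lemma cantor_space_clopen_separation:
  assumes X: "cantor_space X" and "clopenin X A" "x \<in> A" "y \<in> topspace X" "x \<noteq> y"
  obtains B where "clopenin X B" "x \<in> B" "B \<subseteq> A" "y \<notin> B"
proof -
  have "openin X (A - {y})"
    using assms closedin_Hausdorff_singleton[OF cantor_space_imp_Hausdorff[OF X]]
    by (auto simp: clopenin_def intro!: openin_diff)
  moreover have "x \<in> A - {y}" using assms by simp
  ultimately obtain B where "clopenin X B" "x \<in> B" "B \<subseteq> A - {y}"
    using cantor_space_clopen_base[OF X] by metis
  then show ?thesis using that[of B] by blast
qed

section \<open>Ample groups of homeomorphisms\<close>

text \<open>These are the only facts about the full group that the class F argument uses.
  \<open>glue\<close> is ampleness; it speaks of homeomorphisms because local agreement with
  elements of \<open>K\<close> does not force bijectivity.\<close>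

locale ample_homeo_group =
  fixes X :: "'a topology" and K :: "('a \<Rightarrow> 'a) set"
  assumes cantor: "cantor_space X"
    and K_subgroup: "subgroup K (homeo_group X)"
    and glue: "\<And>f. f \<in> carrier (homeo_group X) \<Longrightarrow>
      (\<And>x. x \<in> topspace X \<Longrightarrow> \<exists>V h. openin X V \<and> x \<in> V \<and> h \<in> K \<and> (\<forall>y\<in>V. f y = h y)) \<Longrightarrow> f \<in> K"
    and clopen_supp: "\<And>f. f \<in> K \<Longrightarrow> clopenin X (supp X f)"
    and moves: "\<And>A x. clopenin X A \<Longrightarrow> x \<in> A \<Longrightarrow> \<exists>h\<in>K. h x \<in> A \<and> h x \<noteq> x"
begin

section \<open>Elements of an ample group and involutions glued from them\<close>

lemma K_carrier: "f \<in> K \<Longrightarrow> f \<in> carrier (homeo_group X)"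
  by (rule subgroup.mem_carrier[OF K_subgroup])

lemma K_mem: "f \<in> K \<Longrightarrow> x \<in> topspace X \<Longrightarrow> f x \<in> topspace X"
  by (rule homeo_group_apply_mem[OF K_carrier])

lemma K_id: "(\<lambda>x\<in>topspace X. x) \<in> K"
  using subgroup.one_closed[OF K_subgroup] by (simp add: one_homeo_group)

lemma K_inverse:
  assumes "h \<in> K"
  obtains k where "k \<in> K" "\<And>x. x \<in> topspace X \<Longrightarrow> k (h x) = x"
    "\<And>x. x \<in> topspace X \<Longrightarrow> h (k x) = x"
  using assms inv_homeo_group_apply[OF K_carrier] subgroup.m_inv_closed[OF K_subgroup] by metis

text \<open>An involution is its own inverse, so it is a homeomorphism once it is continuous, and
  continuity is inherited locally from the elements of \<open>K\<close>.\<close>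

lemma K_glue_involution:
  assumes ext: "f \<in> extensional (topspace X)"
    and inv: "\<And>x. x \<in> topspace X \<Longrightarrow> f (f x) = x"
    and loc: "\<And>x. x \<in> topspace X \<Longrightarrow> \<exists>V h. openin X V \<and> x \<in> V \<and> h \<in> K \<and> (\<forall>y\<in>V. f y = h y)"
  shows "f \<in> K"
proof (rule glue)
  have mem: "f x \<in> topspace X" if "x \<in> topspace X" for x
    using loc[OF that] K_mem that by force
  have "openin X {x \<in> topspace X. f x \<in> U}" if U: "openin X U" for U
  proof (subst openin_subopen, clarify)
    fix x assume x: "x \<in> topspace X" "f x \<in> U"
    then obtain V h where V: "openin X V" "x \<in> V" "h \<in> K" "\<forall>y\<in>V. f y = h y"
      using loc by blast
    have "continuous_map X X h"
      using K_carrier[OF V(3)] by (simp add: carrier_homeo_group homeomorphic_imp_continuous_map)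
    then have "openin X (V \<inter> {y \<in> topspace X. h y \<in> U})"
      using V U openin_continuous_map_preimage by blast
    then show "\<exists>T. openin X T \<and> x \<in> T \<and> T \<subseteq> {x \<in> topspace X. f x \<in> U}"
      using V x by (intro exI[of _ "V \<inter> {y \<in> topspace X. h y \<in> U}"]) auto
  qed
  then have "continuous_map X X f"
    using mem by (auto simp: continuous_map_def)
  then show "f \<in> carrier (homeo_group X)"
    using ext inv by (simp add: carrier_homeo_group homeomorphic_map_involution)
qed (rule loc)

lemma K_restrict_involution:
  assumes f: "f \<in> K" and inv: "\<And>x. x \<in> topspace X \<Longrightarrow> f (f x) = x"
    and S: "clopenin X S" and fS: "\<And>x. x \<in> S \<Longrightarrow> f x \<in> S"
  shows "(\<lambda>x\<in>topspace X. if x \<in> S then f x else x) \<in> K"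
proof (rule K_glue_involution)
  let ?f = "\<lambda>x\<in>topspace X. if x \<in> S then f x else x"
  fix x assume x: "x \<in> topspace X"
  show "?f (?f x) = x"
    using x K_mem[OF f] inv fS by auto
  show "\<exists>V h. openin X V \<and> x \<in> V \<and> h \<in> K \<and> (\<forall>y\<in>V. ?f y = h y)"
  proof (cases "x \<in> S")
    case True
    then show ?thesis
      using S f clopenin_subset[OF S] by (intro exI[of _ S] exI[of _ f]) (auto simp: clopenin_def)
  next
    case False
    then show ?thesis
      using S x K_id
      by (intro exI[of _ "topspace X - S"] exI[of _ "\<lambda>x\<in>topspace X. x"]) (auto simp: clopenin_def)
  qed
qed auto

text \<open>The source of all involutions: an element that carries \<open>x\<close> from
  \<open>P\<close> into a disjoint \<open>Q\<close> is turned into an exchange of a piece of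
  \<open>P\<close> with a piece of \<open>Q\<close>.\<close>

lemma K_swap:
  assumes h: "h \<in> K" and P: "clopenin X P" "x \<in> P" and Q: "clopenin X Q" "h x \<in> Q"
    and PQ: "P \<inter> Q = {}"
  obtains s where "s \<in> K" "\<And>y. y \<in> topspace X \<Longrightarrow> s (s y) = y" "s x = h x"
    "\<And>y. y \<in> topspace X \<Longrightarrow> y \<notin> P \<Longrightarrow> y \<notin> Q \<Longrightarrow> s y = y"
proof -
  obtain k where k: "k \<in> K" "\<And>x. x \<in> topspace X \<Longrightarrow> k (h x) = x" "\<And>x. x \<in> topspace X \<Longrightarrow> h (k x) = x"
    using K_inverse[OF h] by blast
  \<comment> \<open>\<open>C\<close> is the image of \<open>B\<close> under \<open>h\<close>. Both
    are clopen, they are disjoint, and \<open>h\<close> and its inverse \<open>k\<close> exchange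
    them.\<close>
  define B where "B = P \<inter> {y \<in> topspace X. h y \<in> Q}"
  define C where "C = Q \<inter> {y \<in> topspace X. k y \<in> P}"
  define s where "s = (\<lambda>y\<in>topspace X. if y \<in> B then h y else if y \<in> C then k y else y)"
  have B: "clopenin X B" "B \<subseteq> topspace X" and C: "clopenin X C" "C \<subseteq> topspace X"
    unfolding B_def C_def using P Q clopenin_preimage K_carrier h k(1) by (auto intro!: clopenin_Int)
  have BC: "B \<inter> C = {}" using PQ by (auto simp: B_def C_def)
  have hB: "h y \<in> C" if "y \<in> B" for y
    using that k K_mem[OF h] by (auto simp: B_def C_def)
  have kC: "k y \<in> B" if "y \<in> C" for y
    using that k K_mem[OF k(1)] by (auto simp: B_def C_def)
  have ss: "s (s y) = y" if y: "y \<in> topspace X" for y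
  proof -
    consider "y \<in> B" | "y \<in> C" "y \<notin> B" | "y \<notin> B" "y \<notin> C" by blast
    then show ?thesis
    proof cases
      case 1
      then show ?thesis using hB[OF 1] k y BC K_mem[OF h y] by (auto simp: s_def)
    next
      case 2
      then show ?thesis using kC[OF 2(1)] k y K_mem[OF k(1) y] by (auto simp: s_def)
    next
      case 3
      then show ?thesis using y by (simp add: s_def)
    qed
  qed
  have "s \<in> K"
  proof (rule K_glue_involution)
    fix y assume y: "y \<in> topspace X"
    show "s (s y) = y"
      by (rule ss[OF y])
    consider "y \<in> B" | "y \<in> C" | "y \<in> topspace X - (B \<union> C)" using y by blast
    then show "\<exists>V h. openin X V \<and> y \<in> V \<and> h \<in> K \<and> (\<forall>y\<in>V. s y = h y)"
    proof cases
      case 1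
      then show ?thesis using B h
        by (intro exI[of _ B] exI[of _ h]) (auto simp: s_def clopenin_def)
    next
      case 2
      then show ?thesis using C k BC
        by (intro exI[of _ C] exI[of _ k]) (auto simp: s_def clopenin_def)
    next
      case 3
      then show ?thesis using B C K_id
        by (intro exI[of _ "topspace X - (B \<union> C)"] exI[of _ "\<lambda>x\<in>topspace X. x"])
          (auto simp: s_def clopenin_def)
    qed
  qed (simp add: s_def)
  moreover note ss
  moreover have "s x = h x"
    using P Q clopenin_subset[OF P(1)] by (auto simp: s_def B_def)
  moreover have "s y = y" if "y \<in> topspace X" "y \<notin> P" "y \<notin> Q" for y
    using that by (auto simp: s_def B_def C_def)
  ultimately show ?thesis using that by blast
qed

text \<open>Involutions are their own inverses, so their commutator can be evaluated without
  inverses.\<close>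

lemma K_commutator_involutions:
  assumes f: "f \<in> K" "\<And>x. x \<in> topspace X \<Longrightarrow> f (f x) = x"
    and g: "g \<in> K" "\<And>x. x \<in> topspace X \<Longrightarrow> g (g x) = x"
    and D: "commutator_subgroup ((homeo_group X)\<lparr>carrier := K\<rparr>) \<subseteq> \<Gamma>"
  obtains c where "c \<in> \<Gamma>" "c \<in> K" "\<And>x. x \<in> topspace X \<Longrightarrow> c x = f (g (f (g x)))"
proof -
  let ?H = "homeo_group X"
  interpret group ?H by (rule group_homeo_group)
  \<comment> \<open>The inverses in \<open>derived_set\<close> are formed in the group with carrier
    \<open>K\<close>; \<open>m_inv_consistent\<close> identifies them with those of the full
    homeomorphism group.\<close>
  have invol: "inv\<^bsub>?H\<lparr>carrier := K\<rparr>\<^esub> u = u" if u: "u \<in> K" "\<And>x. x \<in> topspace X \<Longrightarrow> u (u x) = x" for u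
  proof -
    have "u \<otimes>\<^bsub>?H\<^esub> u = \<one>\<^bsub>?H\<^esub>"
      using K_carrier[OF u(1)] u(2) by (auto simp: mult_homeo_group one_homeo_group compose_def fun_eq_iff restrict_def)
    then have "inv\<^bsub>?H\<^esub> u = u" using K_carrier[OF u(1)] inv_equality by blast
    then show ?thesis using m_inv_consistent[OF K_subgroup u(1)] by simp
  qed
  define c where "c = f \<otimes>\<^bsub>?H\<^esub> g \<otimes>\<^bsub>?H\<^esub> f \<otimes>\<^bsub>?H\<^esub> g"
  have "c \<in> derived_set (?H\<lparr>carrier := K\<rparr>) K"
    using f(1) g(1) invol[OF f] invol[OF g] unfolding c_def by force
  then have "c \<in> \<Gamma>"
    using D by (auto simp: commutator_subgroup_def derived_def intro: generate.incl)
  moreover have "c \<in> K"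
    using f(1) g(1) subgroup.m_closed[OF K_subgroup] by (simp add: c_def)
  moreover have "c x = f (g (f (g x)))" if "x \<in> topspace X" for x
    using that f(1) g(1) K_carrier K_mem by (simp add: c_def mult_homeo_group_apply)
  ultimately show ?thesis using that by blast
qed

text \<open>With \<open>\<tau>\<close> the restriction of \<open>\<alpha>\<close> to a small set \<open>S\<close> and \<open>\<sigma>\<close> an involution commuting
  with \<open>\<alpha>\<close> that moves \<open>S\<close> off itself, the commutator of \<open>\<tau>\<close> and \<open>\<sigma>\<close> is the restriction of
  \<open>\<alpha>\<close> to \<open>S \<union> \<sigma> S\<close>.\<close>

lemma restricted_involution_in_commutator:
  assumes a: "\<alpha> \<in> K" "\<And>x. x \<in> topspace X \<Longrightarrow> \<alpha> (\<alpha> x) = x"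
    and V: "clopenin X V" "x \<in> V" and moved: "\<alpha> x \<noteq> x"
    and D: "commutator_subgroup ((homeo_group X)\<lparr>carrier := K\<rparr>) \<subseteq> \<Gamma>"
  obtains c where "c \<in> \<Gamma>" "c \<in> K" "c x \<noteq> x" "supp X c \<subseteq> V \<union> \<alpha> ` V"
    "\<And>y. y \<in> supp X c \<Longrightarrow> c y = \<alpha> y" "\<And>y. y \<in> topspace X \<Longrightarrow> c (c y) = y"
proof -
  have xX: "x \<in> topspace X" using V clopenin_subset by blast
  note aX = K_mem[OF a(1)]
  obtain V0 where V0: "clopenin X V0" "x \<in> V0" "V0 \<subseteq> V" "\<alpha> x \<notin> V0"
    using cantor_space_clopen_separation[OF cantor V] aX[OF xX] moved by metis
  \<comment> \<open>Discarding the points that \<alpha> keeps in \<open>V0\<close> makes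
    \<open>W\<close> disjoint from its image under \<alpha>; \<open>x\<close> survives because its
    image is outside \<open>V0\<close>.\<close>
  define W where "W = V0 - {y \<in> topspace X. \<alpha> y \<in> V0}"
  have W: "clopenin X W" "x \<in> W" "W \<subseteq> V" and aW: "\<And>y. y \<in> W \<Longrightarrow> \<alpha> y \<notin> W"
    using V0 clopenin_preimage[OF K_carrier[OF a(1)] V0(1)] clopenin_subset[OF V0(1)]
    by (auto simp: W_def intro!: clopenin_Diff)
  have WX: "\<And>y. y \<in> W \<Longrightarrow> y \<in> topspace X" using W(1) clopenin_subset by blast
  obtain h where h: "h \<in> K" "h x \<in> W" "h x \<noteq> x" using moves[OF W(1,2)] by blast
  obtain P where P: "clopenin X P" "x \<in> P" "P \<subseteq> W" "h x \<notin> P"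
    using cantor_space_clopen_separation[OF cantor W(1,2)] WX[OF h(2)] h(3) by metis
  define Q where "Q = W - P"
  have Q: "clopenin X Q" "h x \<in> Q" "Q \<subseteq> W" "P \<inter> Q = {}"
    using W P h by (auto simp: Q_def clopenin_Diff)
  obtain s where s: "s \<in> K" "\<And>y. y \<in> topspace X \<Longrightarrow> s (s y) = y" "s x = h x"
    "\<And>y. y \<in> topspace X \<Longrightarrow> y \<notin> P \<Longrightarrow> y \<notin> Q \<Longrightarrow> s y = y"
    using K_swap[OF h(1) P(1,2) Q(1,2,4)] by blast
  note sX = K_mem[OF s(1)]
  have sW: "s y = y" if "y \<in> topspace X" "y \<notin> W" for y
    using s(4) that P Q by blast
  have sWW: "s y \<in> W" if "y \<in> W" for y
    using sW s(2) sX that WX by metis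
  \<comment> \<open>Only the points that \<open>s\<close> really takes into \<open>Q\<close> are
    kept, so that \<open>s\<close> moves \<open>P'\<close> off itself.\<close>
  define P' where "P' = P \<inter> {y \<in> topspace X. s y \<in> Q}"
  have P': "clopenin X P'" "x \<in> P'" "P' \<subseteq> P" "\<And>y. y \<in> P' \<Longrightarrow> s y \<in> Q"
    using clopenin_preimage[OF K_carrier[OF s(1)] Q(1)] P Q s(3) xX
    by (auto simp: P'_def clopenin_Int)
  have P'W: "\<And>y. y \<in> P' \<Longrightarrow> y \<in> W" using P' P by blast
  \<comment> \<open>\<open>P'\<close> together with its image under \<alpha>: the smallest
    \<alpha>-invariant set containing \<open>P'\<close>. The map \<open>t\<close> below is the
    \<tau> announced above.\<close>
  define S where "S = P' \<union> {y \<in> topspace X. \<alpha> y \<in> P'}"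
  have S: "clopenin X S"
    unfolding S_def using P' clopenin_preimage[OF K_carrier[OF a(1)]] by (auto intro: clopenin_Un)
  have aS: "\<alpha> y \<in> S" if "y \<in> S" for y
    using that a(2) aX P'W WX by (auto simp: S_def)
  define t where "t = (\<lambda>y\<in>topspace X. if y \<in> S then \<alpha> y else y)"
  have tK: "t \<in> K" unfolding t_def by (rule K_restrict_involution[OF a S aS])
  have tt: "t (t y) = y" if "y \<in> topspace X" for y
    using that a(2) aS aX by (auto simp: t_def)
  \<comment> \<open>This is the \<sigma> announced above: \<open>s\<close> times its conjugate by
    \<alpha>. The factors live on \<open>W\<close> and on the image of \<open>W\<close>, which are
    disjoint, so the product is again an involution, and it commutes with \<alpha>.\<close>
  define g where "g = s \<otimes>\<^bsub>homeo_group X\<^esub> \<alpha> \<otimes>\<^bsub>homeo_group X\<^esub> s \<otimes>\<^bsub>homeo_group X\<^esub> \<alpha>"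
  have gK: "g \<in> K"
    using a(1) s(1) subgroup.m_closed[OF K_subgroup] by (simp add: g_def)
  have g: "g y = s (\<alpha> (s (\<alpha> y)))" if "y \<in> topspace X" for y
  proof -
    interpret group "homeo_group X" by (rule group_homeo_group)
    show ?thesis using that a(1) s(1) K_carrier K_mem by (simp add: g_def mult_homeo_group_apply)
  qed
  note gX = K_mem[OF gK]
  have g_eq: "g y = (if y \<in> W then s y else if \<alpha> y \<in> W then \<alpha> (s (\<alpha> y)) else y)"
    if y: "y \<in> topspace X" for y
  proof -
    consider "y \<in> W" | "y \<notin> W" "\<alpha> y \<in> W" | "y \<notin> W" "\<alpha> y \<notin> W" by blast
    then show ?thesis
    proof cases
      case 1
      then show ?thesis using g[OF y] aW sW[OF aX[OF y]] a(2)[OF y] by simp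
    next
      case 2
      have "s (\<alpha> y) \<in> W" by (rule sWW[OF 2(2)])
      then show ?thesis using g[OF y] 2 sW[OF aX[OF WX]] aW by simp
    next
      case 3
      then show ?thesis using g[OF y] sW y aX a(2) by simp
    qed
  qed
  have ga: "g (\<alpha> y) = \<alpha> (g y)" if y: "y \<in> topspace X" for y
    using g_eq[OF y] g_eq[OF aX[OF y]] a(2)[OF y] a(2)[OF sX[OF aX[OF y]]] aW y WX by auto
  have gg: "g (g y) = y" if y: "y \<in> topspace X" for y
    using g_eq[OF y] g_eq[OF gX[OF y]] a(2) sX aX s(2) sWW aW y WX by auto
  \<comment> \<open>\<open>P'\<close> goes into \<open>Q\<close>, which lies in \<open>W\<close> and
    so misses both \<open>P'\<close> and its image under \<alpha>. The other half of
    \<open>S\<close> follows because \<open>g\<close> commutes with \<alpha>.\<close>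
  have gS: "g y \<notin> S" if "y \<in> S" for y
  proof -
    have y: "y \<in> topspace X" using that S clopenin_subset by blast
    have PP: "g z \<notin> S" if z: "z \<in> P'" for z
    proof -
      have "g z = s z" using g_eq[OF WX[OF P'W[OF z]]] P'W[OF z] by simp
      moreover have "s z \<in> Q" using P'(4) z by blast
      then have "s z \<notin> P'" "\<alpha> (s z) \<notin> P'" using P'(3) P'W Q(3,4) aW by blast+
      ultimately show ?thesis by (simp add: S_def)
    qed
    consider "y \<in> P'" | "\<alpha> y \<in> P'" using \<open>y \<in> S\<close> by (auto simp: S_def)
    then show ?thesis
    proof cases
      case 1
      then show ?thesis by (rule PP)
    next
      case 2
      then have "\<alpha> (g y) \<notin> S" using PP ga[OF y] by metis
      then show ?thesis using aS by blast
    qed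
  qed
  obtain c where c: "c \<in> \<Gamma>" "c \<in> K" "\<And>x. x \<in> topspace X \<Longrightarrow> c x = t (g (t (g x)))"
    using K_commutator_involutions[OF tK tt gK gg D] by blast
  \<comment> \<open>As \<open>g\<close> is an involution, \<open>T\<close> is the union of
    \<open>S\<close> and its image under \<open>g\<close>. On either piece exactly one of the two
    factors \<open>t\<close> in \<open>c\<close> acts, and it contributes \<alpha>.\<close>
  define T where "T = S \<union> {y \<in> topspace X. g y \<in> S}"
  have T: "clopenin X T"
    unfolding T_def using S clopenin_preimage[OF K_carrier[OF gK]] by (auto intro: clopenin_Un)
  have c_eq: "c y = (if y \<in> T then \<alpha> y else y)" if y: "y \<in> topspace X" for y
  proof -
    consider "y \<in> S" | "y \<notin> S" "g y \<in> S" | "y \<notin> S" "g y \<notin> S" by blast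
    then show ?thesis
    proof cases
      case 1
      then show ?thesis using c(3)[OF y] gS gg y gX by (simp add: t_def T_def)
    next
      case 2
      then have "\<alpha> y \<notin> S" using aS a(2)[OF y] by metis
      then show ?thesis using c(3)[OF y] 2 y gX aX ga gg a(2) by (simp add: t_def T_def)
    next
      case 3
      then show ?thesis using c(3)[OF y] gg y gX by (simp add: t_def T_def)
    qed
  qed
  have supT: "supp X c \<subseteq> T"
    by (rule supp_subset) (use T c_eq in \<open>auto simp: clopenin_def split: if_splits\<close>)
  have W_img: "y \<in> V \<union> \<alpha> ` V" if "y \<in> topspace X" "y \<in> W \<or> \<alpha> y \<in> W" for y
    using that W(3) a(2) by (metis UnI1 UnI2 image_eqI subsetD)
  have "y \<in> V \<union> \<alpha> ` V" if "y \<in> T" for y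
  proof -
    have y: "y \<in> topspace X" using that T clopenin_subset by blast
    have SW: "z \<in> W \<or> \<alpha> z \<in> W" if "z \<in> S" for z
      using that P'W by (auto simp: S_def)
    have "y \<in> W \<or> \<alpha> y \<in> W"
      using that SW g_eq[OF y] by (auto simp: T_def split: if_splits)
    then show ?thesis using W_img y by blast
  qed
  then have "supp X c \<subseteq> V \<union> \<alpha> ` V" using supT by blast
  moreover have "c x \<noteq> x"
    using c_eq[OF xX] moved P' by (auto simp: T_def S_def)
  moreover have "c y = \<alpha> y" if "y \<in> supp X c" for y
  proof -
    have "y \<in> T" "y \<in> topspace X" using that supT clopenin_subset[OF T] by blast+
    then show ?thesis using c_eq by simp
  qed
  moreover have "c (c y) = y" if y: "y \<in> topspace X" for y
  proof -
    have "\<alpha> z \<in> T" if "z \<in> T" for z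
      using that aS ga aX gX by (auto simp: T_def)
    then show ?thesis using y c_eq a(2) aX by auto
  qed
  ultimately show ?thesis using that c by blast
qed

section \<open>Class F for groups between the commutator subgroup and \<open>K\<close>\<close>

lemma class_F_overgroup_commutators:
  assumes \<Gamma>: "subgroup \<Gamma> (homeo_group X)" "\<Gamma> \<subseteq> K"
    and D: "commutator_subgroup ((homeo_group X)\<lparr>carrier := K\<rparr>) \<subseteq> \<Gamma>"
  shows "class_F X \<Gamma>"
  unfolding class_F_def
proof (intro conjI ballI allI impI; (elim conjE)?)
  show "cantor_space X" by (rule cantor)
  show "subgroup \<Gamma> (homeo_group X)" by (rule \<Gamma>)
  show "clopenin X (supp X \<alpha>)" if "\<alpha> \<in> \<Gamma>" for \<alpha>
    using that \<Gamma> clopen_supp by blast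
next
  fix x A assume A: "clopenin X A" "x \<in> A"
  have xX: "x \<in> topspace X" using A clopenin_subset by blast
  obtain h where h: "h \<in> K" "h x \<in> A" "h x \<noteq> x" using moves[OF A] by blast
  obtain P where P: "clopenin X P" "x \<in> P" "P \<subseteq> A" "h x \<notin> P"
    using cantor_space_clopen_separation[OF cantor A] h K_mem xX by metis
  have "clopenin X (A - P)" "h x \<in> A - P" "P \<inter> (A - P) = {}"
    using A P h by (auto intro: clopenin_Diff)
  \<comment> \<open>For (F1), \<open>s\<close> swaps pieces of the two parts of \<open>A\<close> and
    moves \<open>x\<close>. It preserves \<open>A\<close>, so a restriction of it found in the
    commutator subgroup is supported in \<open>A\<close>.\<close>
  then obtain s where s: "s \<in> K" "\<And>y. y \<in> topspace X \<Longrightarrow> s (s y) = y" "s x = h x"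
    "\<And>y. y \<in> topspace X \<Longrightarrow> y \<notin> P \<Longrightarrow> y \<notin> A - P \<Longrightarrow> s y = y"
    using K_swap[OF h(1) P(1,2)] by metis
  have sA: "s y \<in> A" if "y \<in> A" for y
    using s that P A clopenin_subset K_mem by (metis DiffD1 subsetD)
  obtain c where c: "c \<in> \<Gamma>" "c \<in> K" "c x \<noteq> x" "supp X c \<subseteq> A \<union> s ` A"
    "\<And>y. y \<in> topspace X \<Longrightarrow> c (c y) = y"
    using restricted_involution_in_commutator[OF s(1,2) A _ D] s(3) h(3) by metis
  note cH = K_carrier[OF c(2)]
  show "\<exists>\<alpha>\<in>\<Gamma> - {\<one>\<^bsub>homeo_group X\<^esub>}. x \<in> supp X \<alpha> \<and> supp X \<alpha> \<subseteq> A \<and>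
           \<alpha> [^]\<^bsub>homeo_group X\<^esub> (2::nat) = \<one>\<^bsub>homeo_group X\<^esub>"
  proof (intro bexI[of _ c] conjI)
    show "x \<in> supp X c" using in_supp xX c(3) by metis
    show "supp X c \<subseteq> A" using c(4) sA by blast
    show "c [^]\<^bsub>homeo_group X\<^esub> (2::nat) = \<one>\<^bsub>homeo_group X\<^esub>"
      using homeo_group_square_eq_one_iff[OF cH] c(5) by blast
    show "c \<in> \<Gamma> - {\<one>\<^bsub>homeo_group X\<^esub>}"
      using homeo_group_neq_one_iff[OF cH] c(1,3) xX by blast
  qed
next
  fix \<alpha> A
  assume \<alpha>: "\<alpha> \<in> \<Gamma> - {\<one>\<^bsub>homeo_group X\<^esub>}" "\<alpha> [^]\<^bsub>homeo_group X\<^esub> (2::nat) = \<one>\<^bsub>homeo_group X\<^esub>"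
    and A: "clopenin X A" "A \<noteq> {}" "A \<subseteq> supp X \<alpha>"
  have aK: "\<alpha> \<in> K" using \<alpha> \<Gamma> by blast
  have aa: "\<And>x. x \<in> topspace X \<Longrightarrow> \<alpha> (\<alpha> x) = x"
    using \<alpha> homeo_group_square_eq_one_iff[OF K_carrier[OF aK]] by blast
  obtain y where y: "y \<in> A" using A by blast
  then have "y \<in> X closure_of {x \<in> topspace X. \<alpha> x \<noteq> x}" using A by (auto simp: supp_def)
  moreover have "openin X A" using A by (simp add: clopenin_def)
  \<comment> \<open>For (F2), a point of the support need not be moved, but the open set
    \<open>A\<close> around it contains a point that is.\<close>
  ultimately obtain x where x: "x \<in> A" "\<alpha> x \<noteq> x"
    using y unfolding in_closure_of by blast
  have xX: "x \<in> topspace X" using A x clopenin_subset by blast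
  obtain c where c: "c \<in> \<Gamma>" "c \<in> K" "c x \<noteq> x" "supp X c \<subseteq> A \<union> \<alpha> ` A"
    "\<And>y. y \<in> supp X c \<Longrightarrow> c y = \<alpha> y"
    using restricted_involution_in_commutator[OF aK aa A(1) x D] by metis
  then have "c \<in> \<Gamma> - {\<one>\<^bsub>homeo_group X\<^esub>}"
    using homeo_group_neq_one_iff[OF K_carrier] xX by blast
  then show "\<exists>\<beta>\<in>\<Gamma> - {\<one>\<^bsub>homeo_group X\<^esub>}. supp X \<beta> \<subseteq> A \<union> \<alpha> ` A \<and> (\<forall>x\<in>supp X \<beta>. \<beta> x = \<alpha> x)"
    using c by blast
next
  fix A assume A: "clopenin X A" "A \<noteq> {}"
  then obtain x where x: "x \<in> A" by blast
  have xX: "x \<in> topspace X" using A x clopenin_subset by blast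
  obtain h where h: "h \<in> K" "h x \<in> A" "h x \<noteq> x" using moves[OF A(1) x] by blast
  obtain B where B: "clopenin X B" "x \<in> B" "B \<subseteq> A" "h x \<notin> B"
    using cantor_space_clopen_separation[OF cantor A(1) x] h K_mem xX by metis
  obtain k where k: "k \<in> K" "k x \<in> B" "k x \<noteq> x" using moves[OF B(1,2)] by blast
  obtain P where P: "clopenin X P" "x \<in> P" "P \<subseteq> B" "k x \<notin> P"
    using cantor_space_clopen_separation[OF cantor B(1,2)] k K_mem xX by metis
  \<comment> \<open>For (F3), \<open>P\<close>, \<open>Q\<close> and \<open>R\<close> are disjoint
    clopen neighbourhoods, inside \<open>A\<close>, of the three distinct points \<open>x\<close>,
    \<open>h x\<close> and \<open>k x\<close>.\<close>
  define Q where "Q = A - B"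
  define R where "R = B - P"
  have Q: "clopenin X Q" "h x \<in> Q" "P \<inter> Q = {}" and R: "clopenin X R" "k x \<in> R" "P \<inter> R = {}"
    and QR: "Q \<inter> R = {}" and PQR: "P \<union> Q \<union> R \<subseteq> A"
    using A B P h k by (auto simp: Q_def R_def intro: clopenin_Diff)
  obtain s where s: "s \<in> K" "\<And>y. y \<in> topspace X \<Longrightarrow> s (s y) = y" "s x = h x"
    "\<And>y. y \<in> topspace X \<Longrightarrow> y \<notin> P \<Longrightarrow> y \<notin> Q \<Longrightarrow> s y = y"
    using K_swap[OF h(1) P(1,2) Q] by blast
  obtain t where t: "t \<in> K" "\<And>y. y \<in> topspace X \<Longrightarrow> t (t y) = y" "t x = k x"
    "\<And>y. y \<in> topspace X \<Longrightarrow> y \<notin> P \<Longrightarrow> y \<notin> R \<Longrightarrow> t y = y"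
    using K_swap[OF k(1) P(1,2) R] by blast
  obtain c where c: "c \<in> \<Gamma>" "c \<in> K" "\<And>x. x \<in> topspace X \<Longrightarrow> c x = s (t (s (t x)))"
    using K_commutator_involutions[OF s(1,2) t(1,2) D] by blast
  have hX: "h x \<in> topspace X" and kX: "k x \<in> topspace X" using K_mem h k xX by auto
  have "s (k x) = k x" using s(4)[OF kX] R QR by blast
  moreover have "t (h x) = h x" using t(4)[OF hX] Q QR by blast
  moreover have "s (h x) = x" "t (k x) = x" using s(2,3) t(2,3) xX by metis+
  \<comment> \<open>On these points \<open>s\<close> exchanges \<open>x\<close> with
    \<open>h x\<close> and \<open>t\<close> exchanges \<open>x\<close> with \<open>k x\<close>. The
    commutator is a 3-cycle there, so its square takes \<open>x\<close> to
    \<open>k x\<close>.\<close>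
  ultimately have "c x = h x" "c (h x) = k x"
    using c(3)[OF xX] c(3)[OF hX] s(3) t(3) by simp_all
  then have "c [^]\<^bsub>homeo_group X\<^esub> (2::nat) \<noteq> \<one>\<^bsub>homeo_group X\<^esub>"
    using homeo_group_square_eq_one_iff[OF K_carrier[OF c(2)]] k(3) xX by auto
  moreover have "supp X c \<subseteq> A"
  proof (rule supp_subset)
    show "closedin X A" using A by (simp add: clopenin_def)
    show "y \<in> A" if "y \<in> topspace X" "c y \<noteq> y" for y
    proof (rule ccontr)
      assume "y \<notin> A"
      then have "y \<notin> P" "y \<notin> Q" "y \<notin> R" using PQR by auto
      then have "s y = y" "t y = y" using s(4) t(4) that by auto
      then show False using c(3) that by simp
    qed
  qed
  ultimately show "\<exists>\<alpha>\<in>\<Gamma>. supp X \<alpha> \<subseteq> A \<and> \<alpha> [^]\<^bsub>homeo_group X\<^esub> (2::nat) \<noteq> \<one>\<^bsub>homeo_group X\<^esub>"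
    using c(1) by blast
qed

end

section \<open>The topological full group\<close>

locale etale_cantor_groupoid =
  fixes G :: "'g top_groupoid"
  assumes etale: "etale_groupoid G"
    and principal: "essentially_principal G"
    and cantor: "cantor_space (unit_space G)"
begin

abbreviation "T \<equiv> gtop G"
abbreviation "X \<equiv> unit_space G"
abbreviation "r \<equiv> rng G"
abbreviation "s \<equiv> src G"
abbreviation "i \<equiv> ginv G"
abbreviation mul (infixl "\<cdot>" 70) where "g \<cdot> h \<equiv> gmult G g h"
abbreviation "full_group \<equiv> carrier (topological_full_group G)"

section \<open>Groupoid identities\<close>

lemma is_groupoid: "is_groupoid G"
  using etale by (simp add: etale_groupoid_def topological_groupoid_def)

lemma arrows_closed [simp]:
  "g \<in> arrows G \<Longrightarrow> r g \<in> arrows G" "g \<in> arrows G \<Longrightarrow> s g \<in> arrows G" "g \<in> arrows G \<Longrightarrow> i g \<in> arrows G"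
  using is_groupoid by (auto simp: is_groupoid_def)

lemma rng_src_simps [simp]:
  assumes "g \<in> arrows G"
  shows "r (r g) = r g" "s (r g) = r g" "r (s g) = s g" "s (s g) = s g" "r (i g) = s g" "s (i g) = r g"
  using is_groupoid assms by (auto simp: is_groupoid_def)

lemma gmult_simps [simp]:
  assumes "g \<in> arrows G"
  shows "r g \<cdot> g = g" "g \<cdot> s g = g" "g \<cdot> i g = r g" "i g \<cdot> g = s g"
  using is_groupoid assms by (auto simp: is_groupoid_def)

lemma gmult_closed:
  assumes "g \<in> arrows G" "h \<in> arrows G" "s g = r h"
  shows "g \<cdot> h \<in> arrows G" "r (g \<cdot> h) = r g" "s (g \<cdot> h) = s h"
  using is_groupoid assms unfolding is_groupoid_def composable_def by blast+

lemma gmult_assoc: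
  assumes "g \<in> arrows G" "h \<in> arrows G" "k \<in> arrows G" "s g = r h" "s h = r k"
  shows "(g \<cdot> h) \<cdot> k = g \<cdot> (h \<cdot> k)"
  using is_groupoid assms unfolding is_groupoid_def composable_def by blast

lemma ginv_ginv [simp]:
  assumes g: "g \<in> arrows G"
  shows "i (i g) = g"
proof -
  have "i (i g) = (g \<cdot> i g) \<cdot> i (i g)"
    using g gmult_simps(1)[of "i (i g)"] by simp
  also have "\<dots> = g \<cdot> (i g \<cdot> i (i g))"
    using g by (intro gmult_assoc) auto
  also have "\<dots> = g"
    using g gmult_simps(3)[of "i g"] by simp
  finally show ?thesis .
qed

lemma units_iff: "x \<in> units G \<longleftrightarrow> x \<in> arrows G \<and> r x = x"
  unfolding units_def by force

lemma rng_src_in_units [simp]: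
  "g \<in> arrows G \<Longrightarrow> r g \<in> units G" "g \<in> arrows G \<Longrightarrow> s g \<in> units G"
  by (simp_all add: units_iff)

lemma unitsD: "x \<in> units G \<Longrightarrow> x \<in> arrows G" "x \<in> units G \<Longrightarrow> r x = x" "x \<in> units G \<Longrightarrow> s x = x"
  using rng_src_simps(2)[of x] by (auto simp: units_iff)

section \<open>Range and source as continuous open maps, and compact open bisections\<close>

lemma topspace_T: "topspace T = arrows G"
  by (simp add: arrows_def)

lemma openin_T_subset: "openin T U \<Longrightarrow> U \<subseteq> arrows G"
  using openin_subset topspace_T by metis

lemma topspace_X: "topspace X = units G"
  using unitsD(1) by (auto simp: unit_space_def topspace_T)

lemma Hausdorff_T: "Hausdorff_space T"
  using etale by (simp add: etale_groupoid_def)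

lemma Hausdorff_X: "Hausdorff_space X"
  by (rule cantor_space_imp_Hausdorff[OF cantor])

lemma compact_X: "compact_space X"
  using cantor by (simp add: cantor_space_def)

text \<open>Essential principality presents the unit space as an interior.\<close>

lemma openin_units: "openin T (units G)"
  using principal openin_interior_of[of T] unfolding essentially_principal_def by metis

lemma openin_X_iff: "openin X A \<longleftrightarrow> openin T A \<and> A \<subseteq> units G"
  unfolding unit_space_def using openin_open_subtopology[OF openin_units] .

lemma local_homeo_rng: "local_homeomorphism T X r"
  using etale by (simp add: etale_groupoid_def)

lemma rng_local_chart:
  assumes "g \<in> arrows G"
  obtains U where "openin T U" "g \<in> U" "openin X (r ` U)"
    "homeomorphic_map (subtopology T U) (subtopology X (r ` U)) r"
  using local_homeo_rng assms unfolding local_homeomorphism_def topspace_T by metis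

lemma open_map_rng: "open_map T X r"
  unfolding open_map_def
proof (intro allI impI)
  fix W assume W: "openin T W"
  show "openin X (r ` W)"
  proof (subst openin_subopen, clarify)
    fix g assume g: "g \<in> W"
    then have "g \<in> arrows G" using W openin_T_subset by blast
    then obtain U where U: "openin T U" "g \<in> U" "openin X (r ` U)"
      "homeomorphic_map (subtopology T U) (subtopology X (r ` U)) r"
      by (rule rng_local_chart)
    have "openin (subtopology T U) (U \<inter> W)"
      using W by (simp add: openin_subtopology_Int2)
    then have "openin (subtopology X (r ` U)) (r ` (U \<inter> W))"
      using homeomorphic_imp_open_map[OF U(4)] by (simp add: open_map_def)
    then have "openin X (r ` (U \<inter> W))"
      using U(3) openin_open_subtopology by blast
    then show "\<exists>A. openin X A \<and> r g \<in> A \<and> A \<subseteq> r ` W"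
      using g U(2) by (intro exI[of _ "r ` (U \<inter> W)"]) auto
  qed
qed

lemma continuous_map_rng: "continuous_map T X r"
  unfolding continuous_map_def
proof (intro conjI allI impI)
  show "r \<in> topspace T \<rightarrow> topspace X" by (auto simp: topspace_T topspace_X)
  fix W assume W: "openin X W"
  show "openin T {g \<in> topspace T. r g \<in> W}"
  proof (subst openin_subopen, clarify)
    fix g assume g: "g \<in> topspace T" "r g \<in> W"
    then obtain U where U: "openin T U" "g \<in> U" "openin X (r ` U)"
      "homeomorphic_map (subtopology T U) (subtopology X (r ` U)) r"
      using rng_local_chart topspace_T by metis
    have US: "U \<subseteq> topspace T" using U openin_subset by blast
    have "continuous_map (subtopology T U) X r"
      using homeomorphic_imp_continuous_map[OF U(4)] continuous_map_in_subtopology by blast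
    then have "openin (subtopology T U) {k \<in> topspace (subtopology T U). r k \<in> W}"
      using W openin_continuous_map_preimage by blast
    then have "openin T {k \<in> topspace (subtopology T U). r k \<in> W}"
      using U(1) openin_open_subtopology by blast
    then show "\<exists>A. openin T A \<and> g \<in> A \<and> A \<subseteq> {g \<in> topspace T. r g \<in> W}"
      using g U US by (intro exI[of _ "{k \<in> topspace (subtopology T U). r k \<in> W}"]) auto
  qed
qed

lemma continuous_map_ginv: "continuous_map T T i"
  using etale by (simp add: etale_groupoid_def topological_groupoid_def)

text \<open>Inversion exchanges range and source; it transfers to the source what the etale
  condition gives for the range.\<close>

lemma homeomorphic_map_ginv: "homeomorphic_map T T i"
  using continuous_map_ginv by (rule homeomorphic_map_involution) (simp add: topspace_T)

lemma openin_ginv_image: "openin T U \<Longrightarrow> openin T (i ` U)"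
  using homeomorphic_imp_open_map[OF homeomorphic_map_ginv] by (simp add: open_map_def)

lemma continuous_map_src: "continuous_map T X s"
  by (rule continuous_map_eq[OF continuous_map_compose[OF continuous_map_ginv continuous_map_rng]])
    (simp add: topspace_T)

lemma open_src_image: "openin T U \<Longrightarrow> openin X (s ` U)"
proof -
  assume U: "openin T U"
  then have "s ` U = r ` i ` U"
    using openin_T_subset[OF U] by (force simp: image_image)
  then show ?thesis
    using open_map_rng openin_ginv_image[OF U] by (simp add: open_map_def)
qed

lemma open_rng_image: "openin T U \<Longrightarrow> openin X (r ` U)"
  using open_map_rng by (simp add: open_map_def)

lemma openin_src_preimage:
  assumes "openin X A" "openin T U"
  shows "openin T {g \<in> U. s g \<in> A}"
proof -
  have "{g \<in> U. s g \<in> A} = U \<inter> {g \<in> topspace T. s g \<in> A}"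
    using openin_subset[OF assms(2)] by blast
  then show ?thesis
    using assms openin_continuous_map_preimage[OF continuous_map_src] by auto
qed

lemma openin_rng_preimage:
  assumes "openin X A" "openin T U"
  shows "openin T {g \<in> U. r g \<in> A}"
proof -
  have "{g \<in> U. r g \<in> A} = U \<inter> {g \<in> topspace T. r g \<in> A}"
    using openin_subset[OF assms(2)] by blast
  then show ?thesis
    using assms openin_continuous_map_preimage[OF continuous_map_rng] by auto
qed

lemma src_locally_injective:
  assumes "g \<in> arrows G"
  obtains U where "openin T U" "g \<in> U" "inj_on s U"
proof -
  obtain U where U: "openin T U" "i g \<in> U" "openin X (r ` U)"
    "homeomorphic_map (subtopology T U) (subtopology X (r ` U)) r"
    using rng_local_chart[of "i g"] assms by auto
  have US: "U \<subseteq> arrows G" using U(1) by (rule openin_T_subset)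
  have "inj_on r U"
    using U(4) US by (simp add: homeomorphic_eq_everything_map topspace_T Int_absorb1)
  then have "inj_on s (i ` U)"
    using US by (intro inj_on_imageI) (simp add: inj_on_def subset_iff)
  moreover have "g \<in> i ` U" using U(2) assms by (force intro: image_eqI[of _ _ "i g"])
  ultimately show ?thesis using that[of "i ` U"] openin_ginv_image U(1) by blast
qed

text \<open>A chart of the range map identifies a neighbourhood of \<open>g\<close> with an open
  subset of the Cantor set. Clopen subsets there are compact, and pulling back a small one gives the
  bisection.\<close>

lemma compact_open_bisection_base:
  assumes W: "openin T W" and g: "g \<in> W"
  obtains K where "openin T K" "compactin T K" "inj_on r K" "inj_on s K" "g \<in> K" "K \<subseteq> W"
proof -
  have gA: "g \<in> arrows G" using W g openin_T_subset by blast
  obtain U where U: "openin T U" "g \<in> U" "openin X (r ` U)"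
    "homeomorphic_map (subtopology T U) (subtopology X (r ` U)) r"
    using rng_local_chart[OF gA] by blast
  obtain U' where U': "openin T U'" "g \<in> U'" "inj_on s U'"
    using src_locally_injective[OF gA] by blast
  define O' where "O' = W \<inter> U \<inter> U'"
  have O': "openin T O'" "g \<in> O'" using W U U' g by (auto simp: O'_def)
  obtain V where V: "clopenin X V" "r g \<in> V" "V \<subseteq> r ` O'"
    using cantor_space_clopen_base[OF cantor open_rng_image[OF O'(1)]] O'(2) by blast
  define K where "K = {k \<in> O'. r k \<in> V}"
  have KT: "openin T K"
    unfolding K_def using V O'(1) by (simp add: openin_rng_preimage clopenin_def)
  have KU: "K \<subseteq> U" by (auto simp: K_def O'_def)
  have US: "topspace (subtopology T U) = U"
    using openin_T_subset[OF U(1)] by (auto simp: topspace_T)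
  have rK: "r ` K = V" using V by (auto simp: K_def)
  have "compactin X V"
    using V compact_X by (simp add: clopenin_def closedin_compact_space)
  then have "compactin (subtopology X (r ` U)) (r ` K)"
    using KU by (auto simp: rK[symmetric] compactin_subtopology)
  then have "compactin (subtopology T U) K"
    using homeomorphic_map_compactness[OF U(4), of K] KU unfolding US by blast
  then have "compactin T K" by (simp add: compactin_subtopology)
  moreover have "inj_on r U"
    using U(4) US by (simp add: homeomorphic_eq_everything_map)
  then have "inj_on r K" using KU inj_on_subset by blast
  moreover have "inj_on s K" using U'(3) by (rule inj_on_subset) (auto simp: K_def O'_def)
  moreover have "g \<in> K" "K \<subseteq> W" using V O' by (auto simp: K_def O'_def)
  ultimately show ?thesis using that KT by blast
qed

lemma compact_src_image_closed: "compactin T K \<Longrightarrow> closedin X (s ` K)"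
  using image_compactin[OF _ continuous_map_src] compactin_imp_closedin[OF Hausdorff_X] by blast

lemma compact_rng_image_closed: "compactin T K \<Longrightarrow> closedin X (r ` K)"
  using image_compactin[OF _ continuous_map_rng] compactin_imp_closedin[OF Hausdorff_X] by blast

section \<open>Homeomorphisms given locally by open sets of arrows\<close>

definition implements :: "'g set \<Rightarrow> ('g \<Rightarrow> 'g) \<Rightarrow> bool" where
  "implements U f \<longleftrightarrow> openin T U \<and> (\<forall>g\<in>U. f (s g) = r g)"

text \<open>A local form of membership in the full group that is easy to verify: the sets
  \<open>U\<close> need be neither compact nor \<open>G\<close>-sets, and each may cover only part
  of the unit space.\<close>

definition locally_implemented :: "('g \<Rightarrow> 'g) \<Rightarrow> bool" where
  "locally_implemented f \<longleftrightarrow> (\<forall>x\<in>units G. \<exists>U. implements U f \<and> x \<in> s ` U)"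

lemma full_group_iff:
  "f \<in> full_group \<longleftrightarrow> f \<in> carrier (homeo_group X) \<and>
     (\<exists>U. openin T U \<and> compactin T U \<and> G_set G U \<and> s ` U = units G \<and> r ` U = units G \<and>
       f = G_set_map G U)"
  by (simp add: topological_full_group_def)

lemma G_set_map_src: "G_set G U \<Longrightarrow> g \<in> U \<Longrightarrow> G_set_map G U (s g) = r g"
  by (simp add: G_set_map_def G_set_def)

lemma full_group_locally_implemented: "f \<in> full_group \<Longrightarrow> locally_implemented f"
  unfolding full_group_iff locally_implemented_def implements_def using G_set_map_src by metis

text \<open>Overlaps are removed one set at a time: arrows whose source is already covered are
  deleted. The covered set is clopen, so what remains is still open and compact, and the source
  stays injective.\<close>

lemma implemented_union:
  assumes "finite F" "\<And>V. V \<in> F \<Longrightarrow> implements V f \<and> compactin T V \<and> inj_on s V"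
  shows "\<exists>W. implements W f \<and> compactin T W \<and> inj_on s W \<and> s ` W = (\<Union>V\<in>F. s ` V)"
  using assms
proof (induction F)
  case empty
  show ?case by (intro exI[of _ "{}"]) (simp add: implements_def)
next
  case (insert V F)
  then obtain W where W: "implements W f" "compactin T W" "inj_on s W" "s ` W = (\<Union>V\<in>F. s ` V)"
    by auto
  have V: "implements V f" "compactin T V" "inj_on s V" using insert.prems by auto
  define V' where "V' = {g \<in> V. s g \<in> topspace X - s ` W}"
  have VA: "V \<subseteq> arrows G" using V openin_T_subset by (simp add: implements_def)
  have "openin X (s ` W)" "closedin X (s ` W)"
    using W(1) open_src_image[of W] compact_src_image_closed[OF W(2)]
    unfolding implements_def by blast+
  have V'_open: "openin T V'"
    unfolding V'_def using V(1) \<open>closedin X (s ` W)\<close>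
    by (intro openin_src_preimage) (auto simp: implements_def)
  have "closedin T {g \<in> topspace T. s g \<in> topspace X - s ` W}"
    using \<open>openin X (s ` W)\<close>
    by (intro closedin_continuous_map_preimage[OF continuous_map_src]) auto
  then have "compactin T (V \<inter> {g \<in> topspace T. s g \<in> topspace X - s ` W})"
    using V(2) compact_Int_closedin by blast
  moreover have "V \<inter> {g \<in> topspace T. s g \<in> topspace X - s ` W} = V'"
    using VA by (auto simp: V'_def topspace_T)
  ultimately have V'_compact: "compactin T V'" by simp
  have inj: "inj_on s (W \<union> V')"
  proof -
    have "inj_on s V'" using V(3) by (rule inj_on_subset) (auto simp: V'_def)
    moreover have "s g \<noteq> s h" if "g \<in> W" "h \<in> V'" for g h
      using that by (metis (no_types, lifting) DiffD2 V'_def imageI mem_Collect_eq)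
    ultimately show ?thesis using W(3) unfolding inj_on_def by (metis UnE)
  qed
  have "s ` (W \<union> V') = s ` W \<union> s ` V"
  proof -
    have "s g \<in> s ` W \<or> g \<in> V'" if "g \<in> V" for g
      using that VA by (auto simp: V'_def topspace_X)
    moreover have "V' \<subseteq> V" by (auto simp: V'_def)
    ultimately show ?thesis unfolding image_Un by blast
  qed
  then show ?case
    using W V V'_open V'_compact inj
    by (intro exI[of _ "W \<union> V'"]) (auto simp: implements_def V'_def intro: compactin_Un)
qed

text \<open>By compactness of the unit space finitely many compact open bisections suffice, and they
  merge into one set with injective source.\<close>

lemma full_groupI:
  assumes f: "f \<in> carrier (homeo_group X)" and loc: "locally_implemented f"
  shows "f \<in> full_group"
proof -
  define \<U> where "\<U> = {V. implements V f \<and> compactin T V \<and> inj_on s V}"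
  have "\<exists>V\<in>\<U>. x \<in> s ` V" if x: "x \<in> units G" for x
  proof -
    obtain U g where U: "implements U f" "g \<in> U" "x = s g"
      using loc x unfolding locally_implemented_def by blast
    then obtain K where "openin T K" "compactin T K" "inj_on s K" "g \<in> K" "K \<subseteq> U"
      using compact_open_bisection_base unfolding implements_def by metis
    then have "K \<in> \<U>" using U by (auto simp: \<U>_def implements_def)
    then show ?thesis using \<open>g \<in> K\<close> U by blast
  qed
  then have "topspace X \<subseteq> \<Union> ((`) s ` \<U>)" by (auto simp: topspace_X)
  moreover have "\<forall>A\<in>(`) s ` \<U>. openin X A"
    using open_src_image by (auto simp: \<U>_def implements_def)
  ultimately obtain \<F> where "finite \<F>" "\<F> \<subseteq> (`) s ` \<U>" "topspace X \<subseteq> \<Union>\<F>"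
    using compact_X unfolding compact_space_alt by meson
  then obtain F where F: "finite F" "F \<subseteq> \<U>" "\<F> = (`) s ` F"
    using finite_subset_image by metis
  then obtain W where W: "implements W f" "compactin T W" "inj_on s W" "s ` W = (\<Union>V\<in>F. s ` V)"
    using implemented_union[of F f] by (auto simp: \<U>_def)
  have WA: "W \<subseteq> arrows G" using W openin_T_subset by (simp add: implements_def)
  have sW: "s ` W = units G"
  proof
    show "s ` W \<subseteq> units G" using WA rng_src_in_units(2) by blast
    show "units G \<subseteq> s ` W" using W(4) F \<open>topspace X \<subseteq> \<Union>\<F>\<close> by (simp add: topspace_X)
  qed
  have bij: "bij_betw f (units G) (units G)"
    using homeo_group_Bij[OF f] by (simp add: Bij_def topspace_X)
  have fW: "\<And>g. g \<in> W \<Longrightarrow> f (s g) = r g" using W by (simp add: implements_def)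
  have rW: "r ` W = units G"
    using bij fW by (metis (no_types, lifting) bij_betw_imp_surj_on image_cong image_image sW)
  \<comment> \<open>On \<open>W\<close> the range is \<open>f\<close> after the source, so its
    injectivity comes from that of \<open>f\<close> and of the source.\<close>
  have "inj_on r W"
  proof (rule inj_onI)
    fix g h assume gh: "g \<in> W" "h \<in> W" "r g = r h"
    then have "f (s g) = f (s h)" using fW by simp
    then have "s g = s h"
      using bij gh WA by (auto simp: bij_betw_def dest!: inj_onD)
    then show "g = h" using W(3) gh by (auto dest: inj_onD)
  qed
  then have GW: "G_set G W" using W WA by (simp add: G_set_def)
  have "f = G_set_map G W"
  proof (rule extensionalityI)
    show "f \<in> extensional (units G)" using f by (simp add: carrier_homeo_group topspace_X)
    show "G_set_map G W \<in> extensional (units G)" by (simp add: G_set_map_def sW)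
    show "f x = G_set_map G W x" if "x \<in> units G" for x
    proof -
      obtain g where "g \<in> W" "x = s g" using \<open>x \<in> units G\<close> sW by blast
      then show ?thesis using fW G_set_map_src[OF GW] by simp
    qed
  qed
  then show ?thesis
    unfolding full_group_iff using f W GW sW rW by (auto simp: implements_def)
qed

text \<open>Near each point \<open>f\<close> lifts a unit along the source and takes the range. Both
  maps are open and continuous, which gives continuity and openness of \<open>f\<close>
  locally.\<close>

lemma locally_implemented_homeo:
  assumes ext: "f \<in> extensional (units G)" and bij: "bij_betw f (units G) (units G)"
    and loc: "locally_implemented f"
  shows "f \<in> carrier (homeo_group X)"
proof -
  have "homeomorphic_map X X f"
  proof (rule bijective_open_imp_homeomorphic_map)
    show "f ` topspace X = topspace X" "inj_on f (topspace X)"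
      using bij by (auto simp: topspace_X bij_betw_def)
    show "continuous_map X X f"
      unfolding continuous_map_def
    proof (intro conjI allI impI)
      show "f \<in> topspace X \<rightarrow> topspace X"
        using bij bij_betw_imp_funcset by (auto simp: topspace_X)
      fix A assume A: "openin X A"
      show "openin X {x \<in> topspace X. f x \<in> A}"
      proof (subst openin_subopen, clarify)
        fix x assume x: "x \<in> topspace X" "f x \<in> A"
        then obtain U g where U: "implements U f" "g \<in> U" "x = s g"
          using loc unfolding locally_implemented_def topspace_X by blast
        have "openin X (s ` {g \<in> U. r g \<in> A})"
          using U A by (intro open_src_image openin_rng_preimage) (auto simp: implements_def)
        moreover have "x \<in> s ` {g \<in> U. r g \<in> A}" using U x by (auto simp: implements_def)
        moreover have "s ` {g \<in> U. r g \<in> A} \<subseteq> {x \<in> topspace X. f x \<in> A}"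
          using U openin_T_subset[of U] rng_src_in_units(2)
          by (auto simp: implements_def topspace_X simp del: rng_src_in_units)
        ultimately show "\<exists>B. openin X B \<and> x \<in> B \<and> B \<subseteq> {x \<in> topspace X. f x \<in> A}" by blast
      qed
    qed
    show "open_map X X f"
      unfolding open_map_def
    proof (intro allI impI)
      fix A assume A: "openin X A"
      show "openin X (f ` A)"
      proof (subst openin_subopen, clarify)
        fix x assume x: "x \<in> A"
        then have "x \<in> units G" using A openin_subset topspace_X by blast
        then obtain U g where U: "implements U f" "g \<in> U" "x = s g"
          using loc unfolding locally_implemented_def by blast
        have "openin X (r ` {g \<in> U. s g \<in> A})"
          using U A by (intro open_rng_image openin_src_preimage) (auto simp: implements_def)
        moreover have "f x \<in> r ` {g \<in> U. s g \<in> A}" using U x by (auto simp: implements_def)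
        moreover have "r ` {g \<in> U. s g \<in> A} \<subseteq> f ` A"
          using U by (force simp: implements_def)
        ultimately show "\<exists>B. openin X B \<and> f x \<in> B \<and> B \<subseteq> f ` A" by blast
      qed
    qed
  qed
  then show ?thesis using ext by (simp add: carrier_homeo_group topspace_X)
qed

text \<open>The composite is implemented by the products of arrows of \<open>U\<close> with arrows
  of \<open>V\<close>; the work lies in showing that this product set is open.\<close>

lemma locally_implemented_compose:
  assumes f: "locally_implemented f" and h: "locally_implemented h"
  shows "locally_implemented (\<lambda>x. f (h x))"
  unfolding locally_implemented_def
proof
  fix x assume x: "x \<in> units G"
  obtain V0 v where V0: "implements V0 h" "v \<in> V0" "x = s v"
    using h x unfolding locally_implemented_def by blast
  obtain V where V: "openin T V" "inj_on s V" "v \<in> V" "V \<subseteq> V0"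
    using compact_open_bisection_base[of V0 v] V0 unfolding implements_def by metis
  have VA: "V \<subseteq> arrows G" using V openin_T_subset by blast
  have hV: "\<And>g. g \<in> V \<Longrightarrow> h (s g) = r g" using V V0 by (auto simp: implements_def)
  obtain U u where U: "implements U f" "u \<in> U" "r v = s u"
    using f V VA rng_src_in_units(1) unfolding locally_implemented_def by blast
  have UA: "U \<subseteq> arrows G" using U openin_T_subset by (simp add: implements_def)
  \<comment> \<open>A section of the source with values in \<open>V\<close>, continuous on the
    source image of \<open>V\<close> because the source map is open.\<close>
  define t where "t = inv_into V s"
  have t: "t (s g) = g" if "g \<in> V" for g
    using V(2) that by (simp add: t_def)
  \<comment> \<open>The open set of arrows \<open>k\<close> that can be multiplied on the right by
    the inverse of \<open>t (s k)\<close>.\<close>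
  define D where "D = {k \<in> arrows G. s k \<in> s ` V}"
  have D: "openin T D"
    using openin_src_preimage[OF open_src_image[OF V(1)] openin_topspace]
    by (simp add: D_def topspace_T)
  have topD: "topspace (subtopology T D) = D" using D_def topspace_T by auto
  have cont_t: "continuous_map (subtopology T D) T (\<lambda>k. t (s k))"
    unfolding continuous_map_def topD
  proof (intro conjI allI impI)
    show "(\<lambda>k. t (s k)) \<in> D \<rightarrow> topspace T"
      using t VA by (auto simp: D_def topspace_T)
    fix A assume A: "openin T A"
    have "t y \<in> A \<longleftrightarrow> y \<in> s ` (V \<inter> A)" if y: "y \<in> s ` V" for y
    proof -
      obtain v where v: "v \<in> V" "y = s v" using y by blast
      then have "y \<in> s ` (V \<inter> A) \<longleftrightarrow> v \<in> A"
        using V(2) by (auto dest: inj_onD)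
      then show ?thesis using v t by simp
    qed
    then have "{k \<in> D. t (s k) \<in> A} = {k \<in> D. s k \<in> s ` (V \<inter> A)}"
      by (auto simp: D_def)
    moreover have "openin T {k \<in> D. s k \<in> s ` (V \<inter> A)}"
      using V A D by (intro openin_src_preimage open_src_image) auto
    ultimately show "openin (subtopology T D) {k \<in> D. t (s k) \<in> A}"
      using openin_subset_topspace_eq openin_open_subtopology[OF D] by auto
  qed
  have tD: "t (s k) \<in> arrows G" "s (t (s k)) = s k" if "k \<in> D" for k
    using that t VA by (auto simp: D_def)
  have "continuous_map (subtopology T D) (prod_topology T T) (\<lambda>k. (k, i (t (s k))))"
    using continuous_map_compose[OF cont_t continuous_map_ginv]
    by (intro continuous_map_pairedI) (auto simp: o_def)
  then have "continuous_map (subtopology T D) (subtopology (prod_topology T T) (composable G))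
      (\<lambda>k. (k, i (t (s k))))"
    using tD by (intro continuous_map_into_subtopology) (auto simp: topD composable_def D_def)
  moreover have "continuous_map (subtopology (prod_topology T T) (composable G)) T (\<lambda>(g, h). g \<cdot> h)"
    using etale by (simp add: etale_groupoid_def topological_groupoid_def)
  ultimately have cont: "continuous_map (subtopology T D) T (\<lambda>k. k \<cdot> i (t (s k)))"
    using continuous_map_compose by (fastforce simp: o_def)
  \<comment> \<open>\<open>W\<close> is the product set: \<open>k\<close> belongs to it exactly when
    cancelling the unique possible right factor from \<open>V\<close> leaves an arrow of
    \<open>U\<close>. As a preimage under a continuous map it is open.\<close>
  define W where "W = {k \<in> D. k \<cdot> i (t (s k)) \<in> U}"
  have "openin (subtopology T D) W"
    using openin_continuous_map_preimage[OF cont, unfolded topD] U(1)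
    unfolding W_def implements_def by blast
  then have "openin T W" using D openin_open_subtopology by blast
  moreover have "f (h (s k)) = r k" if "k \<in> W" for k
  proof -
    have k: "k \<in> D" "k \<in> arrows G" "k \<cdot> i (t (s k)) \<in> U" using that by (auto simp: W_def D_def)
    have tV: "t (s k) \<in> V" using k t by (auto simp: D_def)
    have "h (s k) = r (t (s k))" using hV[OF tV] tD k by simp
    moreover have "s (k \<cdot> i (t (s k))) = r (t (s k))" "r (k \<cdot> i (t (s k))) = r k"
      using gmult_closed(2,3)[of k "i (t (s k))"] k tD by simp_all
    ultimately show ?thesis using U(1) k(3) unfolding implements_def by metis
  qed
  moreover have "x \<in> s ` W"
  proof
    have uv: "u \<in> arrows G" "v \<in> arrows G" "s u = r v" using U V UA VA by auto
    show "x = s (u \<cdot> v)" using gmult_closed(3)[OF uv] V0 by simp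
    have "(u \<cdot> v) \<cdot> i v = u \<cdot> (v \<cdot> i v)" using uv by (intro gmult_assoc) auto
    also have "\<dots> = u" using uv gmult_simps(2)[of u] by simp
    finally show "u \<cdot> v \<in> W"
      using gmult_closed[OF uv] V t U by (auto simp: W_def D_def)
  qed
  ultimately show "\<exists>U. implements U (\<lambda>x. f (h x)) \<and> x \<in> s ` U"
    by (auto simp: implements_def)
qed

lemma locally_implemented_cong:
  assumes "locally_implemented f" "\<And>x. x \<in> units G \<Longrightarrow> f x = f' x"
  shows "locally_implemented f'"
  using assms openin_T_subset unfolding locally_implemented_def implements_def
  by (metis rng_src_in_units(2) subsetD)

section \<open>The topological full group is an ample group\<close>

lemma subgroup_full_group: "subgroup full_group (homeo_group X)"
proof -
  interpret group "homeo_group X" by (rule group_homeo_group)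
  show ?thesis
  proof (rule subgroupI)
    show sub: "full_group \<subseteq> carrier (homeo_group X)" by (auto simp: full_group_iff)
    \<comment> \<open>The identity is implemented by the open set of units.\<close>
    have "implements (units G) \<one>\<^bsub>homeo_group X\<^esub>"
      using openin_units unitsD by (simp add: implements_def one_homeo_group topspace_X)
    moreover have "units G \<subseteq> s ` units G" using unitsD(3) by force
    ultimately have "locally_implemented \<one>\<^bsub>homeo_group X\<^esub>"
      unfolding locally_implemented_def by blast
    then show "full_group \<noteq> {}" using full_groupI one_closed by blast
    fix f assume f: "f \<in> full_group"
    then have fc: "f \<in> carrier (homeo_group X)" using sub by blast
    let ?f' = "inv\<^bsub>homeo_group X\<^esub> f"
    show "?f' \<in> full_group"
    proof (rule full_groupI)
      show "?f' \<in> carrier (homeo_group X)" using fc by simp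
      show "locally_implemented ?f'"
        unfolding locally_implemented_def
      proof
        fix y assume y: "y \<in> units G"
        have x: "?f' y \<in> units G"
          using homeo_group_apply_mem[OF inv_closed[OF fc]] y topspace_X by blast
        then obtain U g where U: "implements U f" "g \<in> U" "?f' y = s g"
          using full_group_locally_implemented[OF f] unfolding locally_implemented_def by blast
        have UA: "U \<subseteq> arrows G" using U openin_T_subset by (simp add: implements_def)
        have "r g = y"
          using U inv_homeo_group_apply(2)[OF fc] y unfolding implements_def topspace_X by metis
        then have "y \<in> s ` i ` U" using U UA by force
        \<comment> \<open>Inverse arrows implement the inverse homeomorphism.\<close>
        moreover have "implements (i ` U) ?f'"
          unfolding implements_def
        proof (intro conjI ballI)
          show "openin T (i ` U)" using U openin_ginv_image by (simp add: implements_def)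
          fix k assume "k \<in> i ` U"
          then obtain g where g: "g \<in> U" "k = i g" by blast
          have "g \<in> arrows G" using g UA by blast
          moreover have "?f' (f (s g)) = s g"
            using inv_homeo_group_apply(1)[OF fc, of "s g"] calculation by (simp add: topspace_X)
          ultimately show "?f' (s k) = r k"
            using g U(1) by (simp add: implements_def)
        qed
        ultimately show "\<exists>U. implements U ?f' \<and> y \<in> s ` U" by blast
      qed
    qed
    fix h assume h: "h \<in> full_group"
    then have hc: "h \<in> carrier (homeo_group X)" using sub by blast
    show "f \<otimes>\<^bsub>homeo_group X\<^esub> h \<in> full_group"
    proof (rule full_groupI)
      show "f \<otimes>\<^bsub>homeo_group X\<^esub> h \<in> carrier (homeo_group X)" using fc hc by simp
      show "locally_implemented (f \<otimes>\<^bsub>homeo_group X\<^esub> h)"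
        using locally_implemented_compose[OF full_group_locally_implemented[OF f]
            full_group_locally_implemented[OF h]]
        by (rule locally_implemented_cong)
          (simp add: mult_homeo_group_apply[OF fc hc] topspace_X)
    qed
  qed
qed

text \<open>Units are the arrows fixed by the continuous range map, and an equalizer in a Hausdorff
  space is closed.\<close>

lemma closedin_units: "closedin T (units G)"
proof -
  have "continuous_map T T r"
    using continuous_map_rng unfolding unit_space_def continuous_map_in_subtopology by blast
  then have "closedin T {g \<in> topspace T. r g = id g}"
    using closedin_continuous_maps_eq[OF Hausdorff_T] continuous_map_id by blast
  moreover have "{g \<in> topspace T. r g = id g} = units G"
    by (auto simp: topspace_T units_iff)
  ultimately show ?thesis by simp
qed

text \<open>Essential principality forces the interior of the fixed point set of \<open>\<pi>\<^sub>U\<close> to be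
  \<open>U \<inter> G\<^sup>(\<^sup>0\<^sup>)\<close>, which is compact because the units are closed.\<close>

lemma clopen_supp_full_group:
  assumes f: "f \<in> full_group"
  shows "clopenin X (supp X f)"
proof -
  obtain U where U: "openin T U" "compactin T U" "G_set G U" "s ` U = units G" "f = G_set_map G U"
    using f unfolding full_group_iff by blast
  have UA: "U \<subseteq> arrows G" using U(1) openin_T_subset by blast
  have fU: "f (s g) = r g" if "g \<in> U" for g using U that G_set_map_src by simp
  define N where "N = U \<inter> units G"
  have N_open: "openin X N" using U openin_units by (auto simp: N_def openin_X_iff)
  have "compactin T N" unfolding N_def
    using U(2) closedin_units compact_Int_closedin by blast
  then have "compactin X N" by (simp add: unit_space_def compactin_subtopology N_def)
  then have N_closed: "closedin X N" using Hausdorff_X compactin_imp_closedin by blast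
  have fN: "f x = x" if "x \<in> N" for x
    using that fU[of x] unitsD[of x] by (simp add: N_def)
  have max: "W \<subseteq> N" if W: "openin X W" "\<And>x. x \<in> W \<Longrightarrow> f x = x" for W
  proof
    fix x assume x: "x \<in> W"
    then have "x \<in> units G" using W openin_X_iff by blast
    then obtain g where g: "g \<in> U" "x = s g" using U by blast
    \<comment> \<open>Over an open set of fixed points the arrows of \<open>U\<close> have equal
      range and source. They form an open set, so essential principality makes them units.\<close>
    have "{k \<in> U. s k \<in> W} \<subseteq> T interior_of {g \<in> arrows G. r g = s g}"
    proof (rule interior_of_maximal)
      show "openin T {k \<in> U. s k \<in> W}" using U W by (simp add: openin_src_preimage)
      show "{k \<in> U. s k \<in> W} \<subseteq> {g \<in> arrows G. r g = s g}"
        using UA fU W(2) by force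
    qed
    then have "g \<in> units G"
      using g x principal by (auto simp: essentially_principal_def)
    then show "x \<in> N" using g unitsD(3) by (simp add: N_def)
  qed
  have "supp X f = topspace X - N"
  proof
    show "supp X f \<subseteq> topspace X - N"
      using N_open fN by (intro supp_subset) auto
    have "openin X (topspace X - supp X f)"
      by (simp add: supp_def openin_diff)
    \<comment> \<open>The complement of the support is an open set of fixed points, so maximality of
      \<open>N\<close> applies to it.\<close>
    then have "topspace X - supp X f \<subseteq> N"
      by (rule max) (use in_supp[of _ X f] in auto)
    then show "topspace X - N \<subseteq> supp X f" by blast
  qed
  then show ?thesis using N_open N_closed by (simp add: clopenin_def openin_diff closedin_diff)
qed

text \<open>A set implementing \<open>h\<close> implements \<open>f\<close> once it is cut down to
  arrows with source in \<open>V\<close>.\<close>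

lemma full_group_glue:
  assumes f: "f \<in> carrier (homeo_group X)"
    and loc: "\<And>x. x \<in> topspace X \<Longrightarrow>
      \<exists>V h. openin X V \<and> x \<in> V \<and> h \<in> full_group \<and> (\<forall>y\<in>V. f y = h y)"
  shows "f \<in> full_group"
proof (rule full_groupI[OF f], unfold locally_implemented_def, rule ballI)
  fix x assume x: "x \<in> units G"
  then obtain V h where V: "openin X V" "x \<in> V" "h \<in> full_group" "\<forall>y\<in>V. f y = h y"
    using loc topspace_X by metis
  obtain U g where U: "implements U h" "g \<in> U" "x = s g"
    using full_group_locally_implemented[OF V(3)] x unfolding locally_implemented_def by blast
  have "implements {g \<in> U. s g \<in> V} f"
    using U V openin_src_preimage by (auto simp: implements_def)
  then show "\<exists>U. implements U f \<and> x \<in> s ` U" using U V by blast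
qed

text \<open>As \<open>x\<close> is not isolated, \<open>A\<close> without \<open>x\<close> is a
  nonempty open set, and by minimality some arrow leads from \<open>x\<close> into it. Swapping
  along a small bisection around that arrow gives an element of the full group.\<close>

lemma full_group_moves:
  assumes min: "minimal_groupoid G" and A: "clopenin X A" "x \<in> A"
  shows "\<exists>h\<in>full_group. h x \<in> A \<and> h x \<noteq> x"
proof -
  have AX: "openin X A" using A by (simp add: clopenin_def)
  have xX: "x \<in> units G" using A clopenin_subset topspace_X by blast
  have "A \<noteq> {x}" using cantor AX xX by (auto simp: cantor_space_def topspace_X)
  then obtain y where y: "y \<in> A - {x}" using A by blast
  have "openin X (A - {x})"
    using AX Hausdorff_X xX by (simp add: openin_diff closedin_Hausdorff_singleton topspace_X)
  moreover have "\<And>V. y \<in> V \<Longrightarrow> openin X V \<Longrightarrow> \<exists>z. z \<in> orbit G x \<and> z \<in> V"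
  proof -
    have "X closure_of orbit G x = units G"
      using min xX unfolding minimal_groupoid_def by (rule bspec)
    then have "y \<in> X closure_of orbit G x" using y AX openin_X_iff[of A] by auto
    then show "\<And>V. y \<in> V \<Longrightarrow> openin X V \<Longrightarrow> \<exists>z. z \<in> orbit G x \<and> z \<in> V"
      by (simp add: in_closure_of)
  qed
  ultimately have "\<exists>z. z \<in> orbit G x \<and> z \<in> A - {x}"
    using y by metis
  then obtain z where "z \<in> orbit G x" "z \<in> A - {x}" by metis
  then obtain g where g: "g \<in> arrows G" "s g = x" "r g \<in> A" "r g \<noteq> x"
    by (auto simp: orbit_def)
  have "r g \<in> units G" using g by simp
  then obtain P Q where P: "openin X P" "x \<in> P" and Q: "openin X Q" "r g \<in> Q" and PQ: "disjnt P Q"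
    using Hausdorff_X xX g(4) unfolding Hausdorff_space_def topspace_X by metis
  \<comment> \<open>Arrows from \<open>P\<close> to \<open>Q\<close>: a bisection among these has
    disjoint source and range sets, so the swap is well defined.\<close>
  have "openin T {k \<in> {k \<in> arrows G. s k \<in> P}. r k \<in> Q}"
    using P Q openin_topspace[of T] unfolding topspace_T
    by (intro openin_rng_preimage openin_src_preimage)
  then obtain U where U: "openin T U" "compactin T U" "inj_on r U" "inj_on s U" "g \<in> U"
    "U \<subseteq> {k \<in> {k \<in> arrows G. s k \<in> P}. r k \<in> Q}"
    using compact_open_bisection_base[of _ g] g P Q by (metis (mono_tags, lifting) mem_Collect_eq)
  have UA: "U \<subseteq> arrows G" using U by blast
  have disj: "s ` U \<inter> r ` U = {}" using U(6) PQ by (fastforce simp: disjnt_iff)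
  \<comment> \<open>The part left fixed. It is open because the source and range sets of the compact
    \<open>U\<close> are closed.\<close>
  define N where "N = topspace X - (s ` U \<union> r ` U)"
  have N: "openin X N"
    unfolding N_def using compact_src_image_closed[OF U(2)] compact_rng_image_closed[OF U(2)]
    by (intro openin_diff closedin_Un openin_topspace)
  \<comment> \<open>This involution is implemented by \<open>U\<close> on its sources, by the
    inverse arrows on its ranges, and by the units in \<open>N\<close> elsewhere.\<close>
  define f where "f = (\<lambda>x\<in>units G. if x \<in> s ` U then r (inv_into U s x)
    else if x \<in> r ` U then s (inv_into U r x) else x)"
  have f_src: "f (s k) = r k" if "k \<in> U" for k
    using that UA U(4) by (auto simp: f_def)
  have f_rng: "f (r k) = s k" if "k \<in> U" for k
    using that UA U(3) disj by (auto simp: f_def)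
  have f_N: "f y = y" if "y \<in> N" for y
    using that by (simp add: f_def N_def topspace_X)
  have cases: "y \<in> s ` U \<or> y \<in> r ` U \<or> y \<in> N" if "y \<in> units G" for y
    using that by (auto simp: N_def topspace_X)
  have ff: "f (f y) = y \<and> f y \<in> units G" if "y \<in> units G" for y
    using cases[OF that] that f_src f_rng f_N UA by auto
  have "bij_betw f (units G) (units G)"
    by (rule bij_betw_byWitness[of _ f]) (use ff in auto)
  moreover have loc: "locally_implemented f"
    unfolding locally_implemented_def
  proof
    fix y assume "y \<in> units G"
    then consider "y \<in> s ` U" | "y \<in> r ` U" | "y \<in> N" using cases by blast
    then show "\<exists>V. implements V f \<and> y \<in> s ` V"
    proof cases
      case 1
      then show ?thesis using U f_src by (auto simp: implements_def)
    next
      case 2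
      have "implements (i ` U) f"
        using openin_ginv_image[OF U(1)] f_rng UA by (auto simp: implements_def)
      moreover have "y \<in> s ` i ` U" using 2 UA by force
      ultimately show ?thesis by blast
    next
      case 3
      have "implements N f"
        using N f_N unitsD by (auto simp: implements_def openin_X_iff)
      moreover have "y \<in> s ` N" using 3 N unitsD(3)[of y] by (force simp: openin_X_iff)
      ultimately show ?thesis by blast
    qed
  qed
  ultimately have "f \<in> full_group"
    by (intro full_groupI locally_implemented_homeo) (auto simp: f_def)
  moreover have "f x = r g" using f_src[OF U(5)] g by simp
  ultimately show ?thesis using g by (intro bexI[of _ f]) auto
qed

end

theorem proposition3p6:
  fixes G :: "'g top_groupoid" and \<Gamma> :: "('g \<Rightarrow> 'g) set"
  assumes "etale_groupoid G"
    and "essentially_principal G"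
    and "cantor_space (unit_space G)"
    and "minimal_groupoid G"
    and "subgroup \<Gamma> (topological_full_group G)"
    and "commutator_subgroup (topological_full_group G) \<subseteq> \<Gamma>"
  shows "class_F (unit_space G) \<Gamma>"
proof -
  interpret etale_cantor_groupoid G
    using assms by unfold_locales
  interpret ample_homeo_group "unit_space G" "carrier (topological_full_group G)"
    by (rule ample_homeo_group.intro[OF assms(3) subgroup_full_group full_group_glue
          clopen_supp_full_group full_group_moves[OF assms(4)]])
  \<comment> \<open>The full group is literally the homeomorphism group with its carrier replaced,
    the form in which subgroups of subgroups and the class F lemma are stated.\<close>
  have tfg: "topological_full_group G =
      (homeo_group (unit_space G))\<lparr>carrier := carrier (topological_full_group G)\<rparr>"
    by (simp add: topological_full_group_def)
  have "subgroup \<Gamma> (homeo_group (unit_space G))"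
    using group.incl_subgroup[OF group_homeo_group subgroup_full_group] assms(5) tfg by simp
  then show ?thesis
    using class_F_overgroup_commutators subgroup.subset[OF assms(5)] assms(6) tfg by simp
qed

end
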